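(* Let $0\le d<1/2$ and let $X_t=\sum_{i=0}^\infty a_i\varepsilon_{t-i}$, $t\ge 1$, be a linear process with memory parameter $d$ (short memory if $d=0$, long memory if $0<d<1/2$, as defined in the context), with i.i.d. mean-zero innovations of variance $\sigma^2\in(0,\infty)$ and $\eta=\mathbb{E}(\varepsilon_1^3)$. Let $k\ge 2$ be an integer and assume that $\mathbb{E}[\varepsilon_1^k]$ is finite. Put $S_n=X_1+\cdots+X_n$ and $$m(d)=\begin{cases}\sum_{i=0}^\infty a_i,&\text{if } d=0,\\ \dfrac{c(d)}{d},&\text{if } 0<d<1/2.\end{cases}$$ Then, as $n\to\infty$: (i) if $k=2p$ with $p\ge 1$ an integer, $$n^{-p(1+2d)}\,\mathbb{E}\left[S_n^k\right]\to (m(d))^k\sigma^k\,\frac{k!}{2^p\,p!}\left(\frac{1}{1+2d}+\int_0^\infty\left((1+x)^d-x^d\right)^2dx\right)^p;$$ (ii) if $k=3+2\ell$ with $\ell\ge 0$ an integer, $$\sqrt{n}\;n^{-\frac{k}{2}(1+2d)}\,\mathbb{E}\left[S_n^k\right]\to (m(d))^k\,\eta\,\sigma^{k-3}\binom{3+2\ell}{3}\frac{(2\ell)!}{2^\ell\,\ell!}\left(\frac{1}{1+3d}+\int_0^\infty\left((1+x)^d-x^d\right)^3dx\right)\left(\frac{1}{1+2d}+\int_0^\infty\left((1+x)^d-x^d\right)^2dx\right)^\ell.$$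
   Context: The innovations $(\varepsilon_i)_{i\in\mathbb{Z}}$ are i.i.d. real random variables with mean $0$, variance $\sigma^2$, $0<\sigma^2<\infty$, and finite third moment. The real coefficients $(a_i)_{i\ge 0}$ are square summable. The process $X_t=\sum_{i=0}^\infty a_i\varepsilon_{t-i}$ (centred, i.e. mean $\mu=0$) is called short memory if $\sum_{i=0}^\infty|a_i|<\infty$, and this case is denoted by $d=0$. It is called long memory with parameter $d\in(0,1/2)$ if $a_i\sim c(d)\,i^{d-1}$ as $i\to\infty$ for some constant $c(d)>0$, where $\ell_n\sim\lambda_n$ means $\ell_n=\lambda_n(1+o(1))$. *)

theory Defs
  imports "HOL-Probability.Probability" "HOL-Library.Landau_Symbols"
begin

locale innovations = prob_space M for M :: "'w measure" +
  fixes \<epsilon> :: "int \<Rightarrow> 'w \<Rightarrow> real" and \<sigma> :: real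
  assumes indep: "indep_vars (\<lambda>_. borel) \<epsilon> UNIV"
    and ident: "distr M borel (\<epsilon> i) = distr M borel (\<epsilon> 1)"
    and third_moment: "integrable M (\<lambda>\<omega>. \<epsilon> 1 \<omega> ^ 3)"
    and mean_zero: "expectation (\<epsilon> 1) = 0"
    and square_integrable: "integrable M (\<lambda>\<omega>. \<epsilon> 1 \<omega> ^ 2)"
    and variance: "variance (\<epsilon> 1) = \<sigma>\<^sup>2"
    and sigma_pos: "\<sigma> > 0"

text \<open>For square summable coefficients and innovations as above the series converges almost
  surely, so the value of \<^const>\<open>suminf\<close> at divergent points only matters on a null set.\<close>

definition linear_process :: "(nat \<Rightarrow> real) \<Rightarrow> (int \<Rightarrow> 'w \<Rightarrow> real) \<Rightarrow> int \<Rightarrow> 'w \<Rightarrow> real" where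
  "linear_process a \<epsilon> t \<omega> = (\<Sum>i. a i * \<epsilon> (t - int i) \<omega>)"

definition partial_sum :: "(int \<Rightarrow> 'w \<Rightarrow> real) \<Rightarrow> nat \<Rightarrow> 'w \<Rightarrow> real" where
  "partial_sum X n \<omega> = (\<Sum>t=1..n. X (int t) \<omega>)"

definition short_memory :: "(nat \<Rightarrow> real) \<Rightarrow> bool" where
  "short_memory a \<longleftrightarrow> summable (\<lambda>i. \<bar>a i\<bar>)"

definition long_memory :: "(nat \<Rightarrow> real) \<Rightarrow> real \<Rightarrow> real \<Rightarrow> bool" where
  "long_memory a d c \<longleftrightarrow> 0 < d \<and> d < 1/2 \<and> c > 0 \<and>
     a \<sim>[sequentially] (\<lambda>i. c * real i powr (d - 1))"

text \<open>The argument \<open>c\<close> is the constant \<open>c(d)\<close> of the long memory case; it is unconstrained and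
  unused when \<open>d = 0\<close>.\<close>

definition memory_parameter :: "(nat \<Rightarrow> real) \<Rightarrow> real \<Rightarrow> real \<Rightarrow> bool" where
  "memory_parameter a d c \<longleftrightarrow> (if d = 0 then short_memory a else long_memory a d c)"

definition memory_const :: "(nat \<Rightarrow> real) \<Rightarrow> real \<Rightarrow> real \<Rightarrow> real" where
  "memory_const a d c = (if d = 0 then (\<Sum>i. a i) else c / d)"

text \<open>The open half-line avoids the point \<open>x = 0\<close>, where \<open>0 powr 0 = 0\<close>.\<close>

definition kernel_integral :: "real \<Rightarrow> nat \<Rightarrow> real" where
  "kernel_integral d q = (LBINT x:{0<..}. ((1 + x) powr d - x powr d) ^ q)"

end

theory Submission
  imports Defs "HOL-Computational_Algebra.Formal_Power_Series" "HOL-Real_Asymp.Real_Asymp"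
begin

text \<open>Almost surely \<open>S n = (\<Sum>s. b n s * \<epsilon> (n - s))\<close> with square summable coefficients
  \<open>b n s\<close>, which are differences of partial sums of \<open>a\<close>. Let \<open>F\<close> be the formal
  exponential generating series of the moments of an innovation and \<open>L = F' / F\<close>. The logarithmic
  derivative of \<open>\<Prod>s. F (b s t)\<close> is a sum, which gives, for the normalised moments
  \<open>g q = E (S n ^ q) / q!\<close> and the power sums \<open>t q = (\<Sum>s. b n s ^ q)\<close>, the recurrence
  \<open>(p + 1) g (p + 1) = (\<Sum>i=1..p. L i * t (i + 1) * g (p - i))\<close>, in which \<open>L 0\<close> does not
  occur because the innovations are centred. A Rosenthal type moment bound carries this identity
  from finite sums to \<open>S n\<close>. Since \<open>t q\<close> is asymptotic to a constant times \<open>n powr (1 + q d)\<close>,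
  only \<open>i = 1\<close> and, for odd moments, \<open>i = 2\<close> contribute to the limit, and these two terms yield
  the Gaussian factors \<open>\<sigma>\<close> and a single factor \<open>\<eta>\<close>.\<close>

text \<open>Expanding \<open>E (S n ^ k)\<close> directly would mean summing over set partitions of
  the \<open>k\<close> factors. The logarithmic derivative avoids this: \<open>L i\<close> is the
  cumulant of order \<open>i + 1\<close> divided by \<open>i!\<close>, and each use of the
  recurrence splits off a single power sum. The series are formal because moments beyond order
  \<open>k\<close> may not exist; an identity for order \<open>q\<close> reads no moment beyond
  order \<open>q\<close>. Two obstacles shape the rest. The process is given by series that need not
  converge absolutely, so Kolmogorov's argument must supply almost sure convergence. Moments then
  pass to the limit only through bounds that are uniform in the number of terms and depend on the l2
  norm of the coefficients alone, since under long memory these are square summable but not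
  summable. In the recurrence the term \<open>i\<close> has order \<open>n\<close> to the power
  \<open>(1 + (i + 1) d) + ((p - i) d + (p - i) div 2)\<close>. The multiples of \<open>d\<close>
  always add up to \<open>(p + 1) d\<close>, so the comparison of terms does not involve
  \<open>d\<close>: the integer \<open>1 + (p - i) div 2\<close> is largest for \<open>i = 1\<close>
  and, when \<open>p\<close> is even, also for \<open>i = 2\<close>.\<close>

section \<open>Almost sure convergence of series of independent variables\<close>

text \<open>The walk with increments \<open>x i\<close>, frozen once it has left \<open>(-l, l)\<close>: bounding its second moment
  gives Kolmogorov's maximal inequality without summing over the exit time.\<close>

primrec stopped_walk :: "real \<Rightarrow> (nat \<Rightarrow> real) \<Rightarrow> nat \<Rightarrow> real" where
  "stopped_walk l x 0 = 0"
| "stopped_walk l x (Suc n) =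
     stopped_walk l x n + (if \<bar>stopped_walk l x n\<bar> < l then x n else 0)"

lemma stopped_walk_cong:
  "(\<And>i. i < n \<Longrightarrow> x i = y i) \<Longrightarrow> stopped_walk l x n = stopped_walk l y n"
  by (induction n) auto

text \<open>The index set \<open>K\<close> stays fixed while \<open>n\<close> decreases in the
  induction. The case \<open>K = {..<n}\<close> expresses that the walk depends on the past
  only.\<close>

lemma measurable_stopped_walk:
  "{..<n} \<subseteq> K \<Longrightarrow> (\<lambda>x. stopped_walk l x n) \<in> borel_measurable (PiM K (\<lambda>_. borel))"
proof (induction n)
  case (Suc n)
  have sub: "{..<n} \<subseteq> K" and nK: "n \<in> K"
    using Suc.prems by auto
  note [measurable] = Suc.IH[OF sub]
  have [measurable]: "(\<lambda>x. x n) \<in> borel_measurable (PiM K (\<lambda>_. borel :: real measure))"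
    using nK by measurable
  show ?case
    by simp
qed auto

lemma stopped_walk_eq_sum:
  "l \<le> \<bar>stopped_walk l x n\<bar> \<or> stopped_walk l x n = (\<Sum>i<n. x i)"
  by (induction n) auto

text \<open>At time \<open>k\<close> the walk either has been stopped outside the interval or still
  equals the partial sum, which lies outside. From then on it is frozen.\<close>

lemma stopped_walk_exceeds:
  assumes "l \<le> \<bar>\<Sum>i<k. x i\<bar>" "k \<le> n"
  shows "l \<le> \<bar>stopped_walk l x n\<bar>"
  using assms(2)
proof (induction n rule: dec_induct)
  case base
  then show ?case
    using stopped_walk_eq_sum[of l x k] assms(1) by auto
qed auto

section \<open>Kolmogorov's maximal inequality and almost sure summability\<close>

context prob_space
begin

text \<open>The singletons \<open>{f j}\<close> are disjoint blocks of indices, so the restrictions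
  to them are independent. This serves for shifting a sequence and for reversing time.\<close>

lemma indep_vars_inj_reindex:
  assumes "indep_vars N X UNIV" "inj f"
  shows "indep_vars (\<lambda>j. N (f j)) (\<lambda>j. X (f j)) UNIV"
proof -
  have "indep_vars (\<lambda>j. PiM {f j} N) (\<lambda>j \<omega>. restrict (\<lambda>i. X i \<omega>) {f j}) UNIV"
    using assms by (intro indep_vars_restrict[OF assms(1)])
      (auto simp: disjoint_family_on_def inj_def)
  from indep_vars_compose2[OF this, of "\<lambda>j x. x (f j)" "\<lambda>j. N (f j)"]
  show ?thesis by simp
qed

lemma indep_var_past:
  fixes X :: "nat \<Rightarrow> 'a \<Rightarrow> real"
  assumes "indep_vars (\<lambda>_. borel) X UNIV"
    and [measurable]: "g \<in> borel_measurable (PiM {..<n} (\<lambda>_. borel))"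
  shows "indep_var borel (\<lambda>\<omega>. g (restrict (\<lambda>i. X i \<omega>) {..<n}) :: real) borel (X n)"
proof -
  have "indep_var borel (g \<circ> (\<lambda>\<omega>. restrict (\<lambda>i. X i \<omega>) {..<n}))
      borel ((\<lambda>f. f n) \<circ> (\<lambda>\<omega>. restrict (\<lambda>i. X i \<omega>) {n}))"
    by (intro indep_var_compose[OF indep_var_restrict[OF assms(1)]]) auto
  then show ?thesis
    by (simp add: comp_def)
qed

text \<open>Whether step \<open>n\<close> is taken is decided by the past, so the increment is an
  indicator times an independent centred variable: the cross term has mean zero and the square adds
  at most \<open>E (X n ^ 2)\<close>.\<close>

lemma stopped_walk_second_moment:
  fixes X :: "nat \<Rightarrow> 'a \<Rightarrow> real"
  assumes ind: "indep_vars (\<lambda>_. borel) X UNIV"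
    and X2: "\<And>i. integrable M (\<lambda>\<omega>. X i \<omega> ^ 2)"
    and X0: "\<And>i. expectation (X i) = 0"
  shows "integrable M (\<lambda>\<omega>. stopped_walk l (\<lambda>i. X i \<omega>) n ^ 2) \<and>
    expectation (\<lambda>\<omega>. stopped_walk l (\<lambda>i. X i \<omega>) n ^ 2) \<le> (\<Sum>i<n. expectation (\<lambda>\<omega>. X i \<omega> ^ 2))"
proof (induction n)
  case (Suc n)
  have [measurable]: "X i \<in> borel_measurable M" for i
    using ind by (auto simp: indep_vars_def)
  have X1: "integrable M (X i)" for i
    by (rule square_integrable_imp_integrable[OF _ X2]) auto
  define Y where "Y \<omega> = stopped_walk l (\<lambda>i. X i \<omega>) n" for \<omega>
  define I where "I y = (if \<bar>y\<bar> < l then 1 else 0 :: real)" for y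
  have [measurable]: "I \<in> borel_measurable borel"
    unfolding I_def by measurable
  have Y_eq: "Y \<omega> = stopped_walk l (restrict (\<lambda>i. X i \<omega>) {..<n}) n" for \<omega>
    unfolding Y_def by (rule stopped_walk_cong) simp
  have indY: "indep_var borel (\<lambda>\<omega>. h (Y \<omega>)) borel (X n)" if "h \<in> borel_measurable borel" for h :: "real \<Rightarrow> real"
    unfolding Y_eq
    by (rule indep_var_past[OF ind measurable_compose[OF measurable_stopped_walk[OF order_refl] that]])
  have [measurable]: "Y \<in> borel_measurable M"
    using indep_var_rv1[OF indY[of "\<lambda>x. x"]] by simp
  \<comment> \<open>The indicator keeps this factor of the cross term bounded, so independence alone
    makes the product integrable.\<close>
  have i1: "integrable M (\<lambda>\<omega>. Y \<omega> * I (Y \<omega>))"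
    by (rule integrable_const_bound[of _ "\<bar>l\<bar>"]) (auto simp: I_def)
  have i2: "integrable M (\<lambda>\<omega>. I (Y \<omega>))"
    by (rule integrable_const_bound[of _ 1]) (auto simp: I_def)
  have a: "indep_var borel (\<lambda>\<omega>. Y \<omega> * I (Y \<omega>)) borel (X n)"
    by (rule indY[of "\<lambda>y. y * I y"]) measurable
  have "indep_var borel ((\<lambda>x. x) \<circ> (\<lambda>\<omega>. I (Y \<omega>))) borel ((\<lambda>x. x ^ 2) \<circ> X n)"
    by (rule indep_var_compose[OF indY]) measurable
  then have b: "indep_var borel (\<lambda>\<omega>. I (Y \<omega>)) borel (\<lambda>\<omega>. X n \<omega> ^ 2)"
    by (simp only: comp_def)
  have j1: "integrable M (\<lambda>\<omega>. Y \<omega> * I (Y \<omega>) * X n \<omega>)"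
    by (rule indep_var_integrable[OF a i1 X1])
  have e1: "expectation (\<lambda>\<omega>. Y \<omega> * I (Y \<omega>) * X n \<omega>) = 0"
    using indep_var_lebesgue_integral[OF a i1 X1] X0 by simp
  have j2: "integrable M (\<lambda>\<omega>. I (Y \<omega>) * X n \<omega> ^ 2)"
    by (rule indep_var_integrable[OF b i2 X2])
  have e2: "expectation (\<lambda>\<omega>. I (Y \<omega>) * X n \<omega> ^ 2) \<le> expectation (\<lambda>\<omega>. X n \<omega> ^ 2)"
    by (rule integral_mono[OF j2 X2]) (auto simp: I_def)
  have eq: "stopped_walk l (\<lambda>i. X i \<omega>) (Suc n) ^ 2 =
      Y \<omega> ^ 2 + 2 * (Y \<omega> * I (Y \<omega>) * X n \<omega>) + I (Y \<omega>) * X n \<omega> ^ 2" for \<omega>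
    by (simp add: Y_def I_def power2_eq_square algebra_simps)
  have IH: "integrable M (\<lambda>\<omega>. Y \<omega> ^ 2)" "expectation (\<lambda>\<omega>. Y \<omega> ^ 2) \<le> (\<Sum>i<n. expectation (\<lambda>\<omega>. X i \<omega> ^ 2))"
    using Suc by (auto simp: Y_def)
  show ?case
    unfolding eq using IH j1 j2 e1 e2 by simp
qed auto

text \<open>A partial sum that reaches \<open>l\<close> at any time forces the stopped walk to end
  outside \<open>(-l, l)\<close>, so Markov's inequality for the square of its final value covers
  all times at once.\<close>

lemma kolmogorov_maximal_inequality:
  fixes X :: "nat \<Rightarrow> 'a \<Rightarrow> real"
  assumes ind: "indep_vars (\<lambda>_. borel) X UNIV"
    and X2: "\<And>i. integrable M (\<lambda>\<omega>. X i \<omega> ^ 2)"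
    and X0: "\<And>i. expectation (X i) = 0"
    and l: "l > 0"
  shows "prob {\<omega>\<in>space M. \<exists>k\<le>n. l \<le> \<bar>\<Sum>i<k. X i \<omega>\<bar>} \<le> (\<Sum>i<n. expectation (\<lambda>\<omega>. X i \<omega> ^ 2)) / l\<^sup>2"
proof -
  have [measurable]: "X i \<in> borel_measurable M" for i
    using ind by (auto simp: indep_vars_def)
  define Y where "Y \<omega> = stopped_walk l (\<lambda>i. X i \<omega>) n" for \<omega>
  note m = stopped_walk_second_moment[OF ind X2 X0, of l n, folded Y_def]
  have [measurable]: "Y \<in> borel_measurable M"
  proof -
    have "(\<lambda>\<omega>. stopped_walk l (\<lambda>i. X i \<omega>) j) \<in> borel_measurable M" for j
      by (induction j) auto
    then show ?thesis by (simp add: Y_def[abs_def])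
  qed
  have "prob {\<omega>\<in>space M. \<exists>k\<le>n. l \<le> \<bar>\<Sum>i<k. X i \<omega>\<bar>} \<le> prob {\<omega>\<in>space M. l\<^sup>2 \<le> Y \<omega> ^ 2}"
  proof (rule finite_measure_mono)
    show "{\<omega>\<in>space M. \<exists>k\<le>n. l \<le> \<bar>\<Sum>i<k. X i \<omega>\<bar>} \<subseteq> {\<omega>\<in>space M. l\<^sup>2 \<le> Y \<omega> ^ 2}"
    proof safe
      fix \<omega> k assume "k \<le> n" "l \<le> \<bar>\<Sum>i<k. X i \<omega>\<bar>"
      then have "\<bar>l\<bar> \<le> \<bar>Y \<omega>\<bar>"
        using stopped_walk_exceeds l by (auto simp: Y_def)
      then show "l\<^sup>2 \<le> Y \<omega> ^ 2"
        by (simp only: abs_le_square_iff)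
    qed
  qed measurable
  also have "\<dots> \<le> expectation (\<lambda>\<omega>. Y \<omega> ^ 2) / l\<^sup>2"
    using m l by (intro integral_Markov_inequality_measure[where A = "{}"]) auto
  also have "\<dots> \<le> (\<Sum>i<n. expectation (\<lambda>\<omega>. X i \<omega> ^ 2)) / l\<^sup>2"
    using m l by (intro divide_right_mono) auto
  finally show ?thesis .
qed

lemma kolmogorov_maximal_inequality_infinite:
  fixes X :: "nat \<Rightarrow> 'a \<Rightarrow> real"
  assumes ind: "indep_vars (\<lambda>_. borel) X UNIV"
    and X2: "\<And>i. integrable M (\<lambda>\<omega>. X i \<omega> ^ 2)"
    and X0: "\<And>i. expectation (X i) = 0"
    and sm: "summable (\<lambda>i. expectation (\<lambda>\<omega>. X i \<omega> ^ 2))"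
    and l: "l > 0"
  shows "prob {\<omega>\<in>space M. \<exists>k. l \<le> \<bar>\<Sum>i<k. X i \<omega>\<bar>} \<le> (\<Sum>i. expectation (\<lambda>\<omega>. X i \<omega> ^ 2)) / l\<^sup>2"
proof -
  have [measurable]: "X i \<in> borel_measurable M" for i
    using ind by (auto simp: indep_vars_def)
  define A where "A n = {\<omega>\<in>space M. \<exists>k\<le>n. l \<le> \<bar>\<Sum>i<k. X i \<omega>\<bar>}" for n
  have "range A \<subseteq> events"
    unfolding A_def by auto
  moreover have "incseq A"
    unfolding A_def incseq_def by (auto intro: order_trans)
  ultimately have lim: "(\<lambda>n. prob (A n)) \<longlonglongrightarrow> prob (\<Union>n. A n)"
    by (intro finite_Lim_measure_incseq) auto
  have "prob (A n) \<le> (\<Sum>i. expectation (\<lambda>\<omega>. X i \<omega> ^ 2)) / l\<^sup>2" for n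
  proof -
    have "prob (A n) \<le> (\<Sum>i<n. expectation (\<lambda>\<omega>. X i \<omega> ^ 2)) / l\<^sup>2"
      unfolding A_def by (rule kolmogorov_maximal_inequality[OF ind X2 X0 l])
    also have "\<dots> \<le> (\<Sum>i. expectation (\<lambda>\<omega>. X i \<omega> ^ 2)) / l\<^sup>2"
      by (intro divide_right_mono sum_le_suminf[OF sm]) auto
    finally show ?thesis .
  qed
  then have "prob (\<Union>n. A n) \<le> (\<Sum>i. expectation (\<lambda>\<omega>. X i \<omega> ^ 2)) / l\<^sup>2"
    by (intro LIMSEQ_le_const2[OF lim]) auto
  also have "(\<Union>n. A n) = {\<omega>\<in>space M. \<exists>k. l \<le> \<bar>\<Sum>i<k. X i \<omega>\<bar>}"
    unfolding A_def by auto
  finally show ?thesis .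
qed

text \<open>Almost surely, for each level \<open>1 / (j + 1)\<close> some tail of the series never
  oscillates by that much; countably many levels make the partial sums Cauchy.\<close>

lemma AE_summable_indep_vars:
  fixes X :: "nat \<Rightarrow> 'a \<Rightarrow> real"
  assumes ind: "indep_vars (\<lambda>_. borel) X UNIV"
    and X2: "\<And>i. integrable M (\<lambda>\<omega>. X i \<omega> ^ 2)"
    and X0: "\<And>i. expectation (X i) = 0"
    and sm: "summable (\<lambda>i. expectation (\<lambda>\<omega>. X i \<omega> ^ 2))"
  shows "AE \<omega> in M. summable (\<lambda>i. X i \<omega>)"
proof -
  have [measurable]: "X i \<in> borel_measurable M" for i
    using ind by (auto simp: indep_vars_def)
  have "AE \<omega> in M. \<exists>N. \<forall>k. \<bar>\<Sum>i<k. X (i + N) \<omega>\<bar> < l" if l: "l > 0" for l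
  proof -
    \<comment> \<open>The event that the tail after \<open>N\<close> ever reaches \<open>l\<close>.
      Its probability is at most a tail of the convergent variance series over the square of
      \<open>l\<close>, so the intersection over all \<open>N\<close> is null.\<close>
    define B where "B N = {\<omega>\<in>space M. \<exists>k. l \<le> \<bar>\<Sum>i<k. X (i + N) \<omega>\<bar>}" for N
    have [measurable]: "B N \<in> events" for N
      unfolding B_def by measurable
    have le: "prob (B N) \<le> (\<Sum>i. expectation (\<lambda>\<omega>. X (i + N) \<omega> ^ 2)) / l\<^sup>2" for N
      unfolding B_def using X2 X0 sm l
      by (intro kolmogorov_maximal_inequality_infinite indep_vars_inj_reindex[OF ind])
         (auto simp: summable_iff_shift[of "\<lambda>i. expectation (\<lambda>\<omega>. X i \<omega> ^ 2)"] inj_def)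
    have "(\<lambda>N. (\<Sum>i. expectation (\<lambda>\<omega>. X (i + N) \<omega> ^ 2)) / l\<^sup>2) \<longlonglongrightarrow> 0 / l\<^sup>2"
      using l by (intro tendsto_divide suminf_exist_split2[OF sm] tendsto_const) auto
    then have lim: "(\<lambda>N. (\<Sum>i. expectation (\<lambda>\<omega>. X (i + N) \<omega> ^ 2)) / l\<^sup>2) \<longlonglongrightarrow> 0" by simp
    have "prob (\<Inter>N. B N) \<le> (\<Sum>i. expectation (\<lambda>\<omega>. X (i + N) \<omega> ^ 2)) / l\<^sup>2" for N
      by (rule order_trans[OF finite_measure_mono le[of N]]) auto
    then have "prob (\<Inter>N. B N) \<le> 0"
      by (intro LIMSEQ_le_const[OF lim]) auto
    then have "prob (\<Inter>N. B N) = 0"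
      using measure_nonneg[of M "\<Inter>N. B N"] by linarith
    moreover have "(\<Inter>N. B N) \<in> events" by measurable
    ultimately have "AE \<omega> in M. \<omega> \<notin> (\<Inter>N. B N)"
      using prob_eq_0 by blast
    with AE_space show ?thesis
      by eventually_elim (auto simp: B_def not_le)
  qed
  then have "AE \<omega> in M. \<forall>j. \<exists>N. \<forall>k. \<bar>\<Sum>i<k. X (i + N) \<omega>\<bar> < inverse (real (Suc j))"
    by (subst AE_all_countable) auto
  then show ?thesis
  proof eventually_elim
    case (elim \<omega>)
    define T where "T n = (\<Sum>i<n. X i \<omega>)" for n
    have shift: "(\<Sum>i<k. X (i + N) \<omega>) = T (N + k) - T N" for k N
      unfolding T_def by (induction k) (auto simp: add.commute)
    have "Cauchy T"
    proof (rule metric_CauchyI)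
      fix e :: real assume "e > 0"
      then obtain j where j: "inverse (real (Suc j)) < e / 2"
        using reals_Archimedean[of "e / 2"] by auto
      obtain N where N: "\<And>k. \<bar>T (N + k) - T N\<bar> < inverse (real (Suc j))"
        using elim[unfolded shift] by blast
      have "dist (T m) (T n) < e" if "m \<ge> N" "n \<ge> N" for m n
        using N[of "m - N"] N[of "n - N"] j that by (auto simp: dist_real_def)
      then show "\<exists>N. \<forall>m\<ge>N. \<forall>n\<ge>N. dist (T m) (T n) < e" by blast
    qed
    then show ?case
      unfolding T_def by (simp add: Cauchy_convergent_iff summable_iff_convergent)
  qed
qed

end

section \<open>Moment generating series and moment inequalities\<close>

text \<open>The formal counterpart of \<open>E (exp (t b X))\<close>. The coefficient of order
  \<open>q\<close> involves the moment of order \<open>q\<close> only, so values of the integral at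
  moments that do not exist stay in coefficients of higher order.\<close>

definition moment_fps :: "(nat \<Rightarrow> real) \<Rightarrow> real \<Rightarrow> real fps" where
  "moment_fps \<mu> b = Abs_fps (\<lambda>q. b ^ q * \<mu> q / fact q)"

text \<open>The derivative of the cumulant generating series: coefficient \<open>i\<close> is the
  cumulant of order \<open>i + 1\<close> over \<open>i!\<close>.\<close>

definition log_deriv_fps :: "(nat \<Rightarrow> real) \<Rightarrow> real fps" where
  "log_deriv_fps \<mu> = fps_deriv (moment_fps \<mu> 1) * inverse (moment_fps \<mu> 1)"

text \<open>This is \<open>F' = F L\<close> with \<open>t\<close> replaced by \<open>b t\<close>.
  Multiplying the identity between the coefficients of order \<open>n\<close> by
  \<open>b ^ (n + 1)\<close> avoids composition of series and covers \<open>b = 0\<close>.\<close>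

lemma fps_deriv_moment_fps:
  assumes "\<mu> 0 = 1"
  shows "fps_deriv (moment_fps \<mu> b) =
    moment_fps \<mu> b * Abs_fps (\<lambda>i. fps_nth (log_deriv_fps \<mu>) i * b ^ Suc i)"
proof (rule fps_ext)
  fix n
  have "fps_nth (moment_fps \<mu> 1) 0 \<noteq> 0"
    using assms by (simp add: moment_fps_def)
  then have inv: "moment_fps \<mu> 1 * inverse (moment_fps \<mu> 1) = 1"
    by (rule inverse_mult_eq_1')
  have "fps_deriv (moment_fps \<mu> 1) = moment_fps \<mu> 1 * log_deriv_fps \<mu>"
    unfolding log_deriv_fps_def by (simp only: mult.left_commute[of "moment_fps \<mu> 1"] inv mult_1_right)
  then have "fps_nth (fps_deriv (moment_fps \<mu> 1)) n = fps_nth (moment_fps \<mu> 1 * log_deriv_fps \<mu>) n"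
    by simp
  then have *: "real (Suc n) * (\<mu> (Suc n) / fact (Suc n)) =
      (\<Sum>i=0..n. \<mu> i / fact i * fps_nth (log_deriv_fps \<mu>) (n - i))"
    by (simp add: fps_mult_nth moment_fps_def)
  have "fps_nth (fps_deriv (moment_fps \<mu> b)) n = b ^ Suc n * (real (Suc n) * (\<mu> (Suc n) / fact (Suc n)))"
    by (simp add: moment_fps_def)
  also have "\<dots> = (\<Sum>i=0..n. (b ^ i * \<mu> i / fact i) * (fps_nth (log_deriv_fps \<mu>) (n - i) * b ^ Suc (n - i)))"
    unfolding * sum_distrib_left
  proof (rule sum.cong)
    fix i assume "i \<in> {0..n}"
    then have p: "b ^ Suc n = b ^ i * b ^ Suc (n - i)"
      by (simp flip: power_add)
    then show "b ^ Suc n * (\<mu> i / fact i * fps_nth (log_deriv_fps \<mu>) (n - i)) =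
       (b ^ i * \<mu> i / fact i) * (fps_nth (log_deriv_fps \<mu>) (n - i) * b ^ Suc (n - i))"
      unfolding p by (simp only: mult_ac times_divide_eq_left times_divide_eq_right)
  qed simp
  also have "\<dots> = fps_nth (moment_fps \<mu> b * Abs_fps (\<lambda>i. fps_nth (log_deriv_fps \<mu>) i * b ^ Suc i)) n"
    by (simp add: fps_mult_nth moment_fps_def)
  finally show "fps_nth (fps_deriv (moment_fps \<mu> b)) n = \<dots>" .
qed

lemma fps_deriv_prod_moment_fps:
  assumes "\<mu> 0 = 1"
  shows "fps_deriv (\<Prod>s<N::nat. moment_fps \<mu> (b s)) =
    (\<Prod>s<N. moment_fps \<mu> (b s)) * Abs_fps (\<lambda>i. fps_nth (log_deriv_fps \<mu>) i * (\<Sum>s<N. b s ^ Suc i))"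
proof (induction N)
  case 0
  show ?case by (simp add: fps_eq_iff)
next
  case (Suc N)
  have split: "Abs_fps (\<lambda>i. fps_nth (log_deriv_fps \<mu>) i * (\<Sum>s<Suc N. b s ^ Suc i)) =
      Abs_fps (\<lambda>i. fps_nth (log_deriv_fps \<mu>) i * (\<Sum>s<N. b s ^ Suc i)) +
      Abs_fps (\<lambda>i. fps_nth (log_deriv_fps \<mu>) i * b N ^ Suc i)"
    by (simp add: fps_eq_iff algebra_simps)
  show ?case
    unfolding split prod.lessThan_Suc
    by (simp add: Suc.IH fps_deriv_moment_fps[of \<mu>, OF assms] algebra_simps)
qed

text \<open>For a centred variable the second and third cumulants are the moments themselves; the
  half in the last value is \<open>1 / 2!\<close>.\<close>

lemma log_deriv_fps_nth:
  assumes "\<mu> 0 = 1" "\<mu> 1 = 0"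
  shows "fps_nth (log_deriv_fps \<mu>) 0 = 0" "fps_nth (log_deriv_fps \<mu>) 1 = \<mu> 2" "fps_nth (log_deriv_fps \<mu>) 2 = \<mu> 3 / 2"
proof -
  let ?L = "log_deriv_fps \<mu>"
  have "fps_deriv (moment_fps \<mu> 1) = moment_fps \<mu> 1 * ?L"
    using fps_deriv_moment_fps[of \<mu> 1, OF assms(1)] by (simp add: fps_nth_inverse)
  then have eq: "fps_nth (fps_deriv (moment_fps \<mu> 1)) n = fps_nth (moment_fps \<mu> 1 * ?L) n" for n
    by simp
  show 0: "fps_nth ?L 0 = 0"
    using eq[of 0] assms by (simp add: moment_fps_def)
  show 1: "fps_nth ?L 1 = \<mu> 2"
    using eq[of 1] assms by (simp add: moment_fps_def fps_mult_nth numeral_2_eq_2)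
  show "fps_nth ?L 2 = \<mu> 3 / 2"
    using eq[of 2] assms 0 1
    by (simp add: moment_fps_def fps_mult_nth numeral_2_eq_2 numeral_3_eq_3)
qed

text \<open>The linear term is kept exactly because its expectation vanishes when \<open>x\<close>
  is centred and independent of \<open>u\<close>. The remainder is quadratic in \<open>x\<close>
  where \<open>u\<close> dominates and a pure power of \<open>x\<close> where \<open>x\<close>
  dominates.\<close>

lemma abs_power_add_le:
  fixes q :: nat
  shows "\<exists>C\<ge>0. \<forall>u x::real. \<bar>u + x\<bar> ^ (q + 2) \<le>
    \<bar>u\<bar> ^ (q + 2) + real (q + 2) * (sgn u * \<bar>u\<bar> ^ (q + 1)) * x + C * (\<bar>u\<bar> ^ q * x\<^sup>2 + \<bar>x\<bar> ^ (q + 2))"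
proof -
  \<comment> \<open>The range where \<open>u\<close> dominates, by induction on the exponent:
    multiply the previous inequality by \<open>u + x\<close>, which lies between 0 and
    \<open>2 u\<close>.\<close>
  have "\<exists>D\<ge>0. \<forall>u x::real. \<bar>x\<bar> \<le> u \<longrightarrow>
      (u + x) ^ (q + 2) \<le> u ^ (q + 2) + real (q + 2) * u ^ (q + 1) * x + D * (u ^ q * x\<^sup>2)"
  proof (induction q)
    case 0
    show ?case by (rule exI[of _ 1]) (simp add: power2_eq_square algebra_simps)
  next
    case (Suc q)
    then obtain D where D: "D \<ge> 0" "\<And>u x::real. \<bar>x\<bar> \<le> u \<Longrightarrow>
      (u + x) ^ (q + 2) \<le> u ^ (q + 2) + real (q + 2) * u ^ (q + 1) * x + D * (u ^ q * x\<^sup>2)"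
      by blast
    have "(u + x) ^ (Suc q + 2) \<le> u ^ (Suc q + 2) + real (Suc q + 2) * u ^ (Suc q + 1) * x
        + (2 * D + real (q + 2)) * (u ^ Suc q * x\<^sup>2)" if xu: "\<bar>x\<bar> \<le> u" for u x :: real
    proof -
      have "(u + x) ^ (Suc q + 2) = (u + x) * (u + x) ^ (q + 2)" by simp
      also have "\<dots> \<le> (u + x) * (u ^ (q + 2) + real (q + 2) * u ^ (q + 1) * x + D * (u ^ q * x\<^sup>2))"
        using xu by (intro mult_left_mono D) auto
      also have "\<dots> = u ^ (Suc q + 2) + real (Suc q + 2) * u ^ (Suc q + 1) * x
          + real (q + 2) * (u ^ Suc q * x\<^sup>2) + D * (u ^ q * x\<^sup>2) * (u + x)"
        by (simp add: algebra_simps power2_eq_square)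
      also have "D * (u ^ q * x\<^sup>2) * (u + x) \<le> D * (u ^ q * x\<^sup>2) * (2 * u)"
        using xu D(1) by (intro mult_left_mono) auto
      finally show ?thesis by (simp add: algebra_simps)
    qed
    then show ?case using D(1) by (intro exI[of _ "2 * D + real (q + 2)"]) auto
  qed
  then obtain D where D: "D \<ge> 0" "\<And>u x::real. \<bar>x\<bar> \<le> u \<Longrightarrow>
      (u + x) ^ (q + 2) \<le> u ^ (q + 2) + real (q + 2) * u ^ (q + 1) * x + D * (u ^ q * x\<^sup>2)"
    by blast
  \<comment> \<open>\<open>D\<close> serves the range where \<open>u\<close> dominates. Otherwise
    \<open>2 ^ (q + 2)\<close> bounds the left-hand side and \<open>q + 2\<close> compensates a
    negative linear term.\<close>
  define C where "C = D + 2 ^ (q + 2) + real (q + 2)"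
  have pos: "\<bar>u + x\<bar> ^ (q + 2) \<le> \<bar>u\<bar> ^ (q + 2) + real (q + 2) * (sgn u * \<bar>u\<bar> ^ (q + 1)) * x
        + C * (\<bar>u\<bar> ^ q * x\<^sup>2 + \<bar>x\<bar> ^ (q + 2))" if u: "u \<ge> 0" for u x :: real
  proof (cases "\<bar>x\<bar> \<le> u")
    case True
    show ?thesis
    proof (cases "u = 0")
      case False
      with u have u0: "u > 0" by simp
      have "\<bar>u + x\<bar> ^ (q + 2) = (u + x) ^ (q + 2)"
        using True by simp
      also have "\<dots> \<le> u ^ (q + 2) + real (q + 2) * u ^ (q + 1) * x + D * (u ^ q * x\<^sup>2)"
        by (rule D(2)[OF True])
      also have "D * (u ^ q * x\<^sup>2) \<le> C * (u ^ q * x\<^sup>2 + \<bar>x\<bar> ^ (q + 2))"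
        using D(1) u by (intro mult_mono) (auto simp: C_def)
      finally show ?thesis using u0 by simp
    qed (use True in simp)
  next
    case False
    have "\<bar>u + x\<bar> ^ (q + 2) \<le> (2 * \<bar>x\<bar>) ^ (q + 2)"
      using False u by (intro power_mono) auto
    then have 1: "\<bar>u + x\<bar> ^ (q + 2) \<le> 2 ^ (q + 2) * \<bar>x\<bar> ^ (q + 2)"
      by (simp only: power_mult_distrib)
    have "\<bar>real (q + 2) * (sgn u * \<bar>u\<bar> ^ (q + 1)) * x\<bar> \<le> real (q + 2) * \<bar>x\<bar> ^ (q + 1) * \<bar>x\<bar>"
      unfolding abs_mult using False u
      by (intro mult_mono) (auto simp: abs_mult sgn_if power_abs simp del: power_Suc intro!: power_mono)
    then have "- (real (q + 2) * \<bar>x\<bar> ^ (q + 2)) \<le> real (q + 2) * (sgn u * \<bar>u\<bar> ^ (q + 1)) * x"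
      by (auto simp: abs_le_iff mult_ac)
    moreover have "(2 ^ (q + 2) + real (q + 2)) * \<bar>x\<bar> ^ (q + 2) \<le> C * (\<bar>u\<bar> ^ q * x\<^sup>2 + \<bar>x\<bar> ^ (q + 2))"
      using D(1) by (intro mult_mono) (auto simp: C_def)
    moreover have "0 \<le> \<bar>u\<bar> ^ (q + 2)" by simp
    ultimately show ?thesis using 1 unfolding distrib_right by linarith
  qed
  have "\<bar>u + x\<bar> ^ (q + 2) \<le> \<bar>u\<bar> ^ (q + 2) + real (q + 2) * (sgn u * \<bar>u\<bar> ^ (q + 1)) * x
        + C * (\<bar>u\<bar> ^ q * x\<^sup>2 + \<bar>x\<bar> ^ (q + 2))" for u x :: real
  proof (cases "u \<ge> 0")
    case False
    have eq: "\<bar>- u + - x\<bar> = \<bar>u + x\<bar>" by arith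
    show ?thesis
      using pos[of "- u" "- x"] False unfolding eq by (simp add: sgn_minus)
  qed (rule pos)
  moreover have "C \<ge> 0" using D(1) by (simp add: C_def)
  ultimately show ?thesis by blast
qed

text \<open>Replaces Hoelder's inequality when passing from small moments of a difference to
  convergence of moments. If \<open>h / x\<close> is small, continuity of \<open>(1 + t) ^ q\<close>
  at 0 gives the first term; otherwise \<open>x\<close> is at most a multiple of
  \<open>h\<close>.\<close>

lemma abs_power_diff_le:
  fixes \<delta> :: real
  assumes "\<delta> > 0"
  shows "\<exists>D\<ge>0. \<forall>x h::real. \<bar>(x + h) ^ q - x ^ q\<bar> \<le> \<delta> * \<bar>x\<bar> ^ q + D * \<bar>h\<bar> ^ q"
proof -
  have "isCont (\<lambda>t::real. (1 + t) ^ q) 0" by (intro continuous_intros)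
  then obtain r where r: "r > 0" "\<And>t::real. \<bar>t\<bar> < r \<Longrightarrow> \<bar>(1 + t) ^ q - 1\<bar> < \<delta>"
    using assms unfolding continuous_at_eps_delta dist_real_def
    by (metis add.right_neutral diff_zero power_one)
  define D where "D = (1 / r + 1) ^ q + (1 / r) ^ q"
  have "\<bar>(x + h) ^ q - x ^ q\<bar> \<le> \<delta> * \<bar>x\<bar> ^ q + D * \<bar>h\<bar> ^ q" for x h :: real
  proof (cases "\<bar>h\<bar> < r * \<bar>x\<bar>")
    case True
    then have x: "x \<noteq> 0" by auto
    have "\<bar>h / x\<bar> < r" using True x by (simp add: divide_simps)
    then have "\<bar>(1 + h / x) ^ q - 1\<bar> * \<bar>x\<bar> ^ q \<le> \<delta> * \<bar>x\<bar> ^ q"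
      using r(2)[of "h / x"] by (intro mult_right_mono) auto
    also have "\<bar>(1 + h / x) ^ q - 1\<bar> * \<bar>x\<bar> ^ q = \<bar>(x + h) ^ q - x ^ q\<bar>"
    proof -
      have "x + h = (1 + h / x) * x"
        using x by (simp add: field_simps)
      then have "(x + h) ^ q = (1 + h / x) ^ q * x ^ q"
        by (simp only: power_mult_distrib)
      then have "(x + h) ^ q - x ^ q = ((1 + h / x) ^ q - 1) * x ^ q"
        by (simp only: left_diff_distrib mult_1)
      then show ?thesis
        by (simp only: abs_mult power_abs)
    qed
    moreover have "0 \<le> D * \<bar>h\<bar> ^ q" using r(1) by (simp add: D_def)
    ultimately show ?thesis by linarith
  next
    case False
    then have x: "\<bar>x\<bar> \<le> 1 / r * \<bar>h\<bar>" using r(1) by (simp add: field_simps)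
    have "\<bar>(x + h) ^ q - x ^ q\<bar> \<le> \<bar>x + h\<bar> ^ q + \<bar>x\<bar> ^ q"
      using abs_triangle_ineq4[of "(x + h) ^ q" "x ^ q"] by (simp add: power_abs)
    also have "\<dots> \<le> ((1 / r + 1) * \<bar>h\<bar>) ^ q + (1 / r * \<bar>h\<bar>) ^ q"
      using x by (intro add_mono power_mono) (auto simp: distrib_right)
    also have "\<dots> = D * \<bar>h\<bar> ^ q"
      by (simp only: D_def power_mult_distrib distrib_right[of _ _ "\<bar>h\<bar> ^ q"])
    moreover have "0 \<le> \<delta> * \<bar>x\<bar> ^ q" using assms by simp
    ultimately show ?thesis by linarith
  qed
  moreover have "D \<ge> 0" using r(1) by (simp add: D_def)
  ultimately show ?thesis by blast
qed

lemma (in prob_space) integrable_abs_power_mono: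
  fixes X :: "'a \<Rightarrow> real"
  assumes [measurable]: "X \<in> borel_measurable M"
    and "integrable M (\<lambda>\<omega>. \<bar>X \<omega>\<bar> ^ k)" "q \<le> k"
  shows "integrable M (\<lambda>\<omega>. \<bar>X \<omega>\<bar> ^ q)"
proof (rule Bochner_Integration.integrable_bound)
  show "integrable M (\<lambda>\<omega>. 1 + \<bar>X \<omega>\<bar> ^ k)"
    using assms by simp
  have "\<bar>x\<bar> ^ q \<le> 1 + \<bar>x\<bar> ^ k" for x :: real
  proof (cases "\<bar>x\<bar> \<le> 1")
    case True
    then have "\<bar>x\<bar> ^ q \<le> 1" by (intro power_le_one) auto
    moreover have "0 \<le> \<bar>x\<bar> ^ k" by simp
    ultimately show ?thesis by linarith
  next
    case False
    then have "\<bar>x\<bar> ^ q \<le> \<bar>x\<bar> ^ k" using assms(3) by (intro power_increasing) auto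
    then show ?thesis by simp
  qed
  then show "AE \<omega> in M. norm (\<bar>X \<omega>\<bar> ^ q) \<le> norm (1 + \<bar>X \<omega>\<bar> ^ k)"
    by (intro AE_I2) (simp add: add_nonneg_nonneg)
qed simp

text \<open>The bound is required from \<open>N\<close> on only: it will be applied to the
  differences of partial sums of lengths \<open>m\<close> and \<open>N\<close>, which are tails just
  for \<open>m\<close> beyond \<open>N\<close>.\<close>

lemma fatou_integral:
  fixes f :: "nat \<Rightarrow> 'a \<Rightarrow> real"
  assumes f: "\<And>n. integrable M (f n)" and nn: "\<And>n x. 0 \<le> f n x"
    and [measurable]: "g \<in> borel_measurable M"
    and lim: "AE x in M. (\<lambda>n. f n x) \<longlonglongrightarrow> g x"
    and bd: "\<And>n. n \<ge> N \<Longrightarrow> integral\<^sup>L M (f n) \<le> B"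
  shows "integrable M g" "integral\<^sup>L M g \<le> B"
proof -
  have [measurable]: "f n \<in> borel_measurable M" for n using f by auto
  have B0: "0 \<le> B"
    using bd[OF order_refl] Bochner_Integration.integral_nonneg[of M "f N"] nn by (blast intro: order_trans)
  have g0: "AE x in M. 0 \<le> g x"
    using lim by eventually_elim (rule LIMSEQ_le_const, auto simp: nn)
  have "(\<integral>\<^sup>+ x. ennreal (g x) \<partial>M) = (\<integral>\<^sup>+ x. liminf (\<lambda>n. ennreal (f n x)) \<partial>M)"
  proof (rule nn_integral_cong_AE)
    show "AE x in M. ennreal (g x) = liminf (\<lambda>n. ennreal (f n x))"
      using lim
    proof eventually_elim
      case (elim x)
      then have "(\<lambda>n. ennreal (f n x)) \<longlonglongrightarrow> ennreal (g x)"
        by (rule tendsto_ennrealI)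
      then show ?case
        by (rule lim_imp_Liminf[OF sequentially_bot, symmetric])
    qed
  qed
  also have "\<dots> \<le> liminf (\<lambda>n. \<integral>\<^sup>+ x. ennreal (f n x) \<partial>M)"
    by (rule nn_integral_liminf) auto
  also have "\<dots> \<le> limsup (\<lambda>n. \<integral>\<^sup>+ x. ennreal (f n x) \<partial>M)"
    by (rule Liminf_le_Limsup) auto
  also have "\<dots> \<le> ennreal B"
  proof (rule Limsup_bounded)
    show "\<forall>\<^sub>F n in sequentially. (\<integral>\<^sup>+ x. ennreal (f n x) \<partial>M) \<le> ennreal B"
      using eventually_ge_at_top[of N]
    proof eventually_elim
      case (elim n)
      show ?case
        using bd[OF elim] nn f by (subst nn_integral_eq_integral) (auto intro: ennreal_leI)
    qed
  qed
  finally have le: "(\<integral>\<^sup>+ x. ennreal (g x) \<partial>M) \<le> ennreal B" .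
  show i: "integrable M g"
    using le g0 by (intro integrableI_nonneg) (auto simp: order_le_less_trans)
  show "integral\<^sup>L M g \<le> B"
    using le B0 nn_integral_eq_integral[OF i g0] by simp
qed

lemma summable_power_ge_2:
  fixes b :: "nat \<Rightarrow> real"
  assumes b2: "summable (\<lambda>s. (b s)\<^sup>2)" and q: "q \<ge> 2"
  shows "summable (\<lambda>s. \<bar>b s\<bar> ^ q)"
proof (rule summable_comparison_test_ev[OF _ b2])
  have "(\<lambda>s. (b s)\<^sup>2) \<longlonglongrightarrow> 0" by (rule summable_LIMSEQ_zero[OF b2])
  then have "\<forall>\<^sub>F s in sequentially. (b s)\<^sup>2 < 1"
    by (rule order_tendstoD) simp
  then show "\<forall>\<^sub>F s in sequentially. norm (\<bar>b s\<bar> ^ q) \<le> (b s)\<^sup>2"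
  proof eventually_elim
    case (elim s)
    then have "\<bar>b s\<bar> \<le> 1" by (simp add: abs_square_less_1)
    then have "\<bar>b s\<bar> ^ q \<le> \<bar>b s\<bar> ^ 2" using q by (intro power_decreasing) auto
    then show ?case by (simp add: power_abs)
  qed
qed

lemma integrable_power_of_abs:
  fixes X :: "'a \<Rightarrow> real"
  assumes [measurable]: "X \<in> borel_measurable M" and "integrable M (\<lambda>\<omega>. \<bar>X \<omega>\<bar> ^ q)"
  shows "integrable M (\<lambda>\<omega>. X \<omega> ^ q)"
  using assms(2) by (rule Bochner_Integration.integrable_bound) (auto simp: power_abs)

section \<open>Moments of linear combinations of i.i.d. variables\<close>

lemma (in prob_space) integrable_abs_power_add:
  fixes X Y :: "'a \<Rightarrow> real"
  assumes [measurable]: "X \<in> borel_measurable M" "Y \<in> borel_measurable M"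
    and "integrable M (\<lambda>\<omega>. \<bar>X \<omega>\<bar> ^ q)" "integrable M (\<lambda>\<omega>. \<bar>Y \<omega>\<bar> ^ q)"
  shows "integrable M (\<lambda>\<omega>. \<bar>X \<omega> + Y \<omega>\<bar> ^ q)"
proof (rule Bochner_Integration.integrable_bound)
  show "integrable M (\<lambda>\<omega>. 2 ^ q * \<bar>X \<omega>\<bar> ^ q + 2 ^ q * \<bar>Y \<omega>\<bar> ^ q)"
    using assms by simp
  have "\<bar>x + y\<bar> ^ q \<le> 2 ^ q * \<bar>x\<bar> ^ q + 2 ^ q * \<bar>y\<bar> ^ q" for x y :: real
  proof -
    have "\<bar>x + y\<bar> ^ q \<le> (2 * max \<bar>x\<bar> \<bar>y\<bar>) ^ q"
      by (intro power_mono) auto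
    also have "\<dots> = 2 ^ q * max \<bar>x\<bar> \<bar>y\<bar> ^ q"
      by (rule power_mult_distrib)
    also have "\<dots> \<le> 2 ^ q * (\<bar>x\<bar> ^ q + \<bar>y\<bar> ^ q)"
      by (intro mult_left_mono) (auto simp: max_def)
    finally show ?thesis by (simp only: distrib_left)
  qed
  then show "AE \<omega> in M. norm (\<bar>X \<omega> + Y \<omega>\<bar> ^ q) \<le> norm (2 ^ q * \<bar>X \<omega>\<bar> ^ q + 2 ^ q * \<bar>Y \<omega>\<bar> ^ q)"
    by (intro AE_I2) (simp add: add_nonneg_nonneg)
qed simp

text \<open>Indexed by the lag: for each \<open>n\<close> the instance is
  \<open>e s = \<epsilon> (n - s)\<close>, which turns \<open>S n\<close> into a one-sided
  series.\<close>

locale iid_sequence = prob_space M for M :: "'w measure" +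
  fixes e :: "nat \<Rightarrow> 'w \<Rightarrow> real" and k :: nat
  assumes indep: "indep_vars (\<lambda>_. borel) e UNIV"
    and ident: "distr M borel (e i) = distr M borel (e 0)"
    and mean_zero: "expectation (e 0) = 0"
    and moment_k: "integrable M (\<lambda>\<omega>. e 0 \<omega> ^ k)"
    and k_ge_2: "2 \<le> k"
begin

definition \<mu> :: "nat \<Rightarrow> real" where
  "\<mu> q = expectation (\<lambda>\<omega>. e 0 \<omega> ^ q)"

definition lin_sum :: "(nat \<Rightarrow> real) \<Rightarrow> nat \<Rightarrow> 'w \<Rightarrow> real" where
  "lin_sum b N \<omega> = (\<Sum>s<N. b s * e s \<omega>)"

lemma measurable_e [measurable]: "e i \<in> borel_measurable M"
  using indep by (auto simp: indep_vars_def)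

lemma measurable_lin_sum [measurable]: "lin_sum b N \<in> borel_measurable M"
  unfolding lin_sum_def[abs_def] by measurable

lemma integrable_comp_e:
  fixes f :: "real \<Rightarrow> real"
  assumes [measurable]: "f \<in> borel_measurable borel"
  shows "integrable M (\<lambda>\<omega>. f (e i \<omega>)) \<longleftrightarrow> integrable M (\<lambda>\<omega>. f (e 0 \<omega>))"
proof -
  have "integrable (distr M borel (e i)) f \<longleftrightarrow> integrable (distr M borel (e 0)) f"
    by (simp only: ident[of i])
  then show ?thesis
    by (simp add: integrable_distr_eq)
qed

lemma expectation_comp_e:
  fixes f :: "real \<Rightarrow> real"
  assumes [measurable]: "f \<in> borel_measurable borel"
  shows "expectation (\<lambda>\<omega>. f (e i \<omega>)) = expectation (\<lambda>\<omega>. f (e 0 \<omega>))"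
proof -
  have "integral\<^sup>L (distr M borel (e i)) f = integral\<^sup>L (distr M borel (e 0)) f"
    by (simp only: ident[of i])
  then show ?thesis
    by (simp add: integral_distr)
qed

lemma integrable_abs_e_power:
  assumes "q \<le> k"
  shows "integrable M (\<lambda>\<omega>. \<bar>e i \<omega>\<bar> ^ q)"
proof -
  have "integrable M (\<lambda>\<omega>. \<bar>e 0 \<omega>\<bar> ^ k)"
    using integrable_abs[OF moment_k] by (simp add: power_abs)
  then have "integrable M (\<lambda>\<omega>. \<bar>e 0 \<omega>\<bar> ^ q)"
    by (rule integrable_abs_power_mono[OF measurable_e _ assms])
  then show ?thesis
    using integrable_comp_e[of "\<lambda>x. \<bar>x\<bar> ^ q" i] by simp
qed

lemma integrable_e_power: "q \<le> k \<Longrightarrow> integrable M (\<lambda>\<omega>. e i \<omega> ^ q)"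
  by (rule integrable_power_of_abs[OF measurable_e integrable_abs_e_power])

lemma expectation_e_power: "expectation (\<lambda>\<omega>. e i \<omega> ^ q) = \<mu> q"
  unfolding \<mu>_def by (rule expectation_comp_e) simp

lemma \<mu>_0 [simp]: "\<mu> 0 = 1" and \<mu>_1 [simp]: "\<mu> (Suc 0) = 0"
  using mean_zero by (simp_all add: \<mu>_def prob_space)

lemma integrable_abs_lin_sum_power: "q \<le> k \<Longrightarrow> integrable M (\<lambda>\<omega>. \<bar>lin_sum b N \<omega>\<bar> ^ q)"
proof (induction N)
  case (Suc N)
  then have "integrable M (\<lambda>\<omega>. \<bar>lin_sum b N \<omega> + b N * e N \<omega>\<bar> ^ q)"
    by (intro integrable_abs_power_add) (auto simp: abs_mult power_mult_distrib integrable_abs_e_power)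
  then show ?case
    by (simp add: lin_sum_def)
qed (simp add: lin_sum_def)

lemma integrable_lin_sum_power: "q \<le> k \<Longrightarrow> integrable M (\<lambda>\<omega>. lin_sum b N \<omega> ^ q)"
  by (rule integrable_power_of_abs[OF measurable_lin_sum integrable_abs_lin_sum_power])

lemma indep_var_lin_sum:
  assumes [measurable]: "f \<in> borel_measurable borel" "g \<in> borel_measurable borel"
  shows "indep_var borel (\<lambda>\<omega>. f (lin_sum b N \<omega>) :: real) borel (\<lambda>\<omega>. g (e N \<omega>) :: real)"
proof -
  have "(\<lambda>x. f (\<Sum>s<N. b s * x s)) \<in> borel_measurable (PiM {..<N} (\<lambda>_. borel))"
    by measurable
  from indep_var_past[OF indep this]
  have "indep_var borel (\<lambda>\<omega>. f (lin_sum b N \<omega>)) borel (e N)"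
    by (simp add: lin_sum_def)
  then have "indep_var borel ((\<lambda>x. x) \<circ> (\<lambda>\<omega>. f (lin_sum b N \<omega>))) borel (g \<circ> e N)"
    by (rule indep_var_compose) auto
  then show ?thesis
    by (simp only: comp_def)
qed

lemma
  assumes [measurable]: "f \<in> borel_measurable borel" "g \<in> borel_measurable borel"
    and "integrable M (\<lambda>\<omega>. f (lin_sum b N \<omega>))" "integrable M (\<lambda>\<omega>. g (e N \<omega>))"
  shows integrable_lin_sum_mult: "integrable M (\<lambda>\<omega>. f (lin_sum b N \<omega>) * g (e N \<omega>) :: real)"
    and expectation_lin_sum_mult: "expectation (\<lambda>\<omega>. f (lin_sum b N \<omega>) * g (e N \<omega>)) =
      expectation (\<lambda>\<omega>. f (lin_sum b N \<omega>)) * expectation (\<lambda>\<omega>. g (e N \<omega>))"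
  using indep_var_integrable[OF indep_var_lin_sum[OF assms(1,2)] assms(3,4)]
    indep_var_lebesgue_integral[OF indep_var_lin_sum[OF assms(1,2)] assms(3,4)] by auto

text \<open>After division by factorials, the binomial expansion of a sum of two independent
  variables is the Cauchy product of their exponential series.\<close>

lemma expectation_lin_sum_power:
  assumes "q \<le> k"
  shows "expectation (\<lambda>\<omega>. lin_sum b N \<omega> ^ q) = fact q * fps_nth (\<Prod>s<N. moment_fps \<mu> (b s)) q"
  using assms
proof (induction N arbitrary: q)
  case 0
  show ?case by (cases q) (auto simp: lin_sum_def prob_space)
next
  case (Suc N)
  let ?G = "\<Prod>s<N. moment_fps \<mu> (b s)"
  have int: "integrable M (\<lambda>\<omega>. lin_sum b N \<omega> ^ i * e N \<omega> ^ (q - i))" if "i \<le> q" for i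
    using that Suc.prems
    by (intro integrable_lin_sum_mult integrable_lin_sum_power integrable_e_power) auto
  have "expectation (\<lambda>\<omega>. lin_sum b (Suc N) \<omega> ^ q) =
      expectation (\<lambda>\<omega>. \<Sum>i\<le>q. real (q choose i) * b N ^ (q - i) * (lin_sum b N \<omega> ^ i * e N \<omega> ^ (q - i)))"
    by (intro Bochner_Integration.integral_cong refl)
       (simp add: lin_sum_def binomial_ring power_mult_distrib mult_ac)
  also have "\<dots> = (\<Sum>i\<le>q. real (q choose i) * b N ^ (q - i) *
      expectation (\<lambda>\<omega>. lin_sum b N \<omega> ^ i * e N \<omega> ^ (q - i)))"
    using int by (subst Bochner_Integration.integral_sum) auto
  also have "\<dots> = (\<Sum>i\<le>q. fact q * (fps_nth ?G i * fps_nth (moment_fps \<mu> (b N)) (q - i)))"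
  proof (rule sum.cong)
    fix i assume "i \<in> {..q}"
    then have i: "i \<le> q" "i \<le> k" "q - i \<le> k" using Suc.prems by auto
    have "expectation (\<lambda>\<omega>. lin_sum b N \<omega> ^ i * e N \<omega> ^ (q - i)) =
        expectation (\<lambda>\<omega>. lin_sum b N \<omega> ^ i) * expectation (\<lambda>\<omega>. e N \<omega> ^ (q - i))"
      using i by (intro expectation_lin_sum_mult integrable_lin_sum_power integrable_e_power) auto
    then have "expectation (\<lambda>\<omega>. lin_sum b N \<omega> ^ i * e N \<omega> ^ (q - i)) =
        fact i * fps_nth ?G i * \<mu> (q - i)"
      using Suc.IH[OF i(2)] by (simp add: expectation_e_power)
    then show "real (q choose i) * b N ^ (q - i) *
        expectation (\<lambda>\<omega>. lin_sum b N \<omega> ^ i * e N \<omega> ^ (q - i)) =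
        fact q * (fps_nth ?G i * fps_nth (moment_fps \<mu> (b N)) (q - i))"
      by (simp add: moment_fps_def binomial_fact[OF i(1)] field_simps)
  qed simp
  also have "\<dots> = fact q * fps_nth (\<Prod>s<Suc N. moment_fps \<mu> (b s)) q"
    by (simp add: fps_mult_nth sum_distrib_left atLeast0AtMost)
  finally show ?case .
qed

lemma lin_sum_moment_recurrence:
  assumes "Suc q \<le> k"
  shows "real (Suc q) * (expectation (\<lambda>\<omega>. lin_sum b N \<omega> ^ Suc q) / fact (Suc q)) =
    (\<Sum>i\<le>q. fps_nth (log_deriv_fps \<mu>) i * (\<Sum>s<N. b s ^ Suc i) *
      (expectation (\<lambda>\<omega>. lin_sum b N \<omega> ^ (q - i)) / fact (q - i)))"
proof -
  let ?G = "\<Prod>s<N. moment_fps \<mu> (b s)"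
  let ?H = "Abs_fps (\<lambda>i. fps_nth (log_deriv_fps \<mu>) i * (\<Sum>s<N. b s ^ Suc i))"
  have "fps_deriv ?G = ?H * ?G"
    by (simp add: fps_deriv_prod_moment_fps[of \<mu>, OF \<mu>_0] mult.commute)
  then have "fps_nth (fps_deriv ?G) q = fps_nth (?H * ?G) q"
    by simp
  also have "\<dots> = (\<Sum>i\<le>q. fps_nth (log_deriv_fps \<mu>) i * (\<Sum>s<N. b s ^ Suc i) * fps_nth ?G (q - i))"
    unfolding fps_mult_nth by (simp add: atLeast0AtMost)
  also have "\<dots> = (\<Sum>i\<le>q. fps_nth (log_deriv_fps \<mu>) i * (\<Sum>s<N. b s ^ Suc i) *
      (expectation (\<lambda>\<omega>. lin_sum b N \<omega> ^ (q - i)) / fact (q - i)))"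
    using assms by (intro sum.cong) (auto simp: expectation_lin_sum_power)
  finally show ?thesis
    using expectation_lin_sum_power[OF assms, of b N] by simp
qed

text \<open>The constant depends neither on the coefficients nor on the number of terms, so the
  bound passes to infinite tails. Rosenthal's second term, a sum of \<open>|b s| ^ q\<close>, is
  absorbed for \<open>q \<ge> 2\<close> because it is at most the l2 norm to the power
  \<open>q\<close>.\<close>

definition moment_bounded :: "nat \<Rightarrow> bool" where
  "moment_bounded q \<longleftrightarrow>
    (\<exists>C\<ge>0. \<forall>b N. expectation (\<lambda>\<omega>. \<bar>lin_sum b N \<omega>\<bar> ^ q) \<le> C * sqrt (\<Sum>s<N. (b s)\<^sup>2) ^ q)"

lemma moment_bounded_0: "moment_bounded 0"
  unfolding moment_bounded_def by (intro exI[of _ 1]) (simp add: prob_space)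

text \<open>Adding one summand raises the moment of order \<open>q + 2\<close> by at most
  \<open>K * R ^ q * (b n)\<^sup>2\<close>: the linear term drops out and the quadratic one uses the
  bound of order \<open>q\<close>. These increments sum to \<open>K * R ^ (q + 2)\<close>.\<close>

lemma moment_bounded_step:
  assumes q: "q + 2 \<le> k" and bd: "moment_bounded q"
  shows "moment_bounded (q + 2)"
proof -
  obtain C' where C': "C' \<ge> 0"
    "\<And>b N. expectation (\<lambda>\<omega>. \<bar>lin_sum b N \<omega>\<bar> ^ q) \<le> C' * sqrt (\<Sum>s<N. (b s)\<^sup>2) ^ q"
    using bd unfolding moment_bounded_def by blast
  obtain C where C: "C \<ge> 0" "\<And>u x::real. \<bar>u + x\<bar> ^ (q + 2) \<le>
    \<bar>u\<bar> ^ (q + 2) + real (q + 2) * (sgn u * \<bar>u\<bar> ^ (q + 1)) * x + C * (\<bar>u\<bar> ^ q * x\<^sup>2 + \<bar>x\<bar> ^ (q + 2))"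
    using abs_power_add_le[of q] by blast
  define m where "m = expectation (\<lambda>\<omega>. \<bar>e 0 \<omega>\<bar> ^ (q + 2))"
  have m: "m \<ge> 0" unfolding m_def by (intro Bochner_Integration.integral_nonneg) auto
  have mu2: "\<mu> 2 \<ge> 0" unfolding \<mu>_def by (intro Bochner_Integration.integral_nonneg) auto
  \<comment> \<open>The two summands come from the mixed term and from the pure power of the new
    summand.\<close>
  define K where "K = C * (C' * \<mu> 2 + m)"
  have K: "K \<ge> 0" using C C' m mu2 by (simp add: K_def)
  have "expectation (\<lambda>\<omega>. \<bar>lin_sum b N \<omega>\<bar> ^ (q + 2)) \<le> K * sqrt (\<Sum>s<N. (b s)\<^sup>2) ^ (q + 2)" for b N
  proof -
    \<comment> \<open>The norm of all \<open>N\<close> coefficients, held fixed in the induction on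
      the number \<open>n\<close> of summands so that the increments have a common factor.\<close>
    define R where "R = sqrt (\<Sum>s<N. (b s)\<^sup>2)"
    have R: "R \<ge> 0" by (simp add: R_def sum_nonneg)
    have "expectation (\<lambda>\<omega>. \<bar>lin_sum b n \<omega>\<bar> ^ (q + 2)) \<le> K * R ^ q * (\<Sum>s<n. (b s)\<^sup>2)" if "n \<le> N" for n
      using that
    proof (induction n)
      case 0
      show ?case by (simp add: lin_sum_def)
    next
      case (Suc n)
      let ?T = "lin_sum b n"
      \<comment> \<open>This lets the pure power of the new coefficient be traded for
        \<open>R ^ q * (b n)\<^sup>2\<close>.\<close>
      have b_le: "\<bar>b n\<bar> \<le> R"
        unfolding R_def using Suc.prems
        by (intro real_le_rsqrt) (auto intro!: member_le_sum[of n "{..<N}" "\<lambda>s. (b s)\<^sup>2"])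
      have iT: "integrable M (\<lambda>\<omega>. \<bar>?T \<omega>\<bar> ^ j)" if "j \<le> q + 2" for j
        using that q by (intro integrable_abs_lin_sum_power) auto
      have isT: "integrable M (\<lambda>\<omega>. sgn (?T \<omega>) * \<bar>?T \<omega>\<bar> ^ (q + 1))"
        by (rule Bochner_Integration.integrable_bound[OF iT[of "q + 1"]]) (auto simp: abs_mult sgn_if)
      have ie: "integrable M (\<lambda>\<omega>. e n \<omega>)"
        using integrable_e_power[of 1 n] k_ge_2 by simp
      have ie2: "integrable M (\<lambda>\<omega>. e n \<omega> ^ 2)"
        using integrable_e_power[of 2 n] k_ge_2 by simp
      have Ee: "expectation (e n) = 0"
        using expectation_e_power[of n 1] by simp
      define W0 where "W0 \<omega> = \<bar>?T \<omega>\<bar> ^ (q + 2)" for \<omega>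
      define W1 where "W1 \<omega> = sgn (?T \<omega>) * \<bar>?T \<omega>\<bar> ^ (q + 1) * e n \<omega>" for \<omega>
      define W2 where "W2 \<omega> = \<bar>?T \<omega>\<bar> ^ q * e n \<omega> ^ 2" for \<omega>
      define W3 where "W3 \<omega> = \<bar>e n \<omega>\<bar> ^ (q + 2)" for \<omega>
      have iW0: "integrable M W0"
        unfolding W0_def[abs_def] by (rule iT) simp
      have iW1: "integrable M W1"
        unfolding W1_def[abs_def]
        by (rule integrable_lin_sum_mult[of "\<lambda>u. sgn u * \<bar>u\<bar> ^ (q + 1)" "\<lambda>x. x", OF _ _ isT ie]) measurable
      have "expectation W1 = expectation (\<lambda>\<omega>. sgn (?T \<omega>) * \<bar>?T \<omega>\<bar> ^ (q + 1)) * expectation (e n)"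
        unfolding W1_def[abs_def]
        by (rule expectation_lin_sum_mult[of "\<lambda>u. sgn u * \<bar>u\<bar> ^ (q + 1)" "\<lambda>x. x", OF _ _ isT ie]) measurable
      then have EW1: "expectation W1 = 0"
        by (simp only: Ee mult_zero_right)
      have iTq: "integrable M (\<lambda>\<omega>. \<bar>?T \<omega>\<bar> ^ q)"
        by (rule iT) simp
      have iW2: "integrable M W2"
        unfolding W2_def[abs_def]
        by (rule integrable_lin_sum_mult[of "\<lambda>u. \<bar>u\<bar> ^ q" "\<lambda>x. x ^ 2", OF _ _ iTq ie2]) measurable
      have EW2: "expectation W2 = expectation (\<lambda>\<omega>. \<bar>?T \<omega>\<bar> ^ q) * \<mu> 2"
        unfolding W2_def[abs_def] expectation_e_power[of n 2, symmetric]
        by (rule expectation_lin_sum_mult[of "\<lambda>u. \<bar>u\<bar> ^ q" "\<lambda>x. x ^ 2", OF _ _ iTq ie2]) measurable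
      have iW3: "integrable M W3"
        unfolding W3_def[abs_def] using q by (rule integrable_abs_e_power)
      have EW3: "expectation W3 = m"
        unfolding m_def W3_def[abs_def] by (rule expectation_comp_e) simp
      have "expectation (\<lambda>\<omega>. \<bar>lin_sum b (Suc n) \<omega>\<bar> ^ (q + 2)) \<le>
        expectation (\<lambda>\<omega>. W0 \<omega> + real (q + 2) * b n * W1 \<omega> + C * (b n)\<^sup>2 * W2 \<omega> + C * \<bar>b n\<bar> ^ (q + 2) * W3 \<omega>)"
      proof (rule integral_mono)
        show "integrable M (\<lambda>\<omega>. \<bar>lin_sum b (Suc n) \<omega>\<bar> ^ (q + 2))"
          using q by (rule integrable_abs_lin_sum_power)
        show "integrable M (\<lambda>\<omega>. W0 \<omega> + real (q + 2) * b n * W1 \<omega> + C * (b n)\<^sup>2 * W2 \<omega> + C * \<bar>b n\<bar> ^ (q + 2) * W3 \<omega>)"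
          by (intro Bochner_Integration.integrable_add integrable_mult_right iW0 iW1 iW2 iW3)
        fix \<omega>
        have "lin_sum b (Suc n) \<omega> = ?T \<omega> + b n * e n \<omega>"
          by (simp add: lin_sum_def)
        then show "\<bar>lin_sum b (Suc n) \<omega>\<bar> ^ (q + 2) \<le>
          W0 \<omega> + real (q + 2) * b n * W1 \<omega> + C * (b n)\<^sup>2 * W2 \<omega> + C * \<bar>b n\<bar> ^ (q + 2) * W3 \<omega>"
          using C(2)[of "?T \<omega>" "b n * e n \<omega>"]
          by (simp only: W0_def W1_def W2_def W3_def power_mult_distrib abs_mult distrib_left mult_ac add_ac)
      qed
      also have "\<dots> = expectation W0
          + C * (b n)\<^sup>2 * (expectation (\<lambda>\<omega>. \<bar>?T \<omega>\<bar> ^ q) * \<mu> 2) + C * \<bar>b n\<bar> ^ (q + 2) * m"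
        by (simp add: iW0 iW1 iW2 iW3 EW1 EW2 EW3 del: power_Suc)
      also have "\<dots> \<le> expectation W0 + C * (b n)\<^sup>2 * (C' * R ^ q * \<mu> 2) + C * (R ^ q * (b n)\<^sup>2) * m"
      proof (intro add_mono mult_left_mono mult_right_mono order_refl)
        have "expectation (\<lambda>\<omega>. \<bar>?T \<omega>\<bar> ^ q) \<le> C' * sqrt (\<Sum>s<n. (b s)\<^sup>2) ^ q"
          by (rule C'(2))
        also have "\<dots> \<le> C' * R ^ q"
          unfolding R_def using Suc.prems C'(1)
          by (intro mult_left_mono power_mono real_sqrt_le_mono sum_mono2) (auto simp: sum_nonneg)
        finally show "expectation (\<lambda>\<omega>. \<bar>?T \<omega>\<bar> ^ q) \<le> C' * R ^ q" .
        have "\<bar>b n\<bar> ^ (q + 2) = \<bar>b n\<bar> ^ q * (b n)\<^sup>2"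
          by (simp only: power_add power2_abs)
        also have "\<dots> \<le> R ^ q * (b n)\<^sup>2"
          using b_le by (intro mult_right_mono power_mono) auto
        finally show "\<bar>b n\<bar> ^ (q + 2) \<le> R ^ q * (b n)\<^sup>2" .
      qed (use C(1) mu2 m in auto)
      also have "\<dots> = expectation W0 + K * R ^ q * (b n)\<^sup>2"
        by (simp add: K_def algebra_simps)
      also have "\<dots> \<le> K * R ^ q * (\<Sum>s<n. (b s)\<^sup>2) + K * R ^ q * (b n)\<^sup>2"
        using Suc by (simp add: W0_def[abs_def])
      finally show ?case by (simp add: algebra_simps)
    qed
    from this[of N] have "expectation (\<lambda>\<omega>. \<bar>lin_sum b N \<omega>\<bar> ^ (q + 2)) \<le> K * R ^ q * (\<Sum>s<N. (b s)\<^sup>2)"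
      by simp
    also have "(\<Sum>s<N. (b s)\<^sup>2) = R\<^sup>2"
      by (simp add: R_def sum_nonneg)
    finally show ?thesis
      by (simp only: R_def power_add mult.assoc)
  qed
  then show ?thesis
    unfolding moment_bounded_def using K by blast
qed

text \<open>The induction advances by two, so order 1 needs its own start. It follows from order 2
  by comparing the absolute value with \<open>x\<^sup>2 / R + R\<close>, where \<open>R\<close> is
  the natural scale of the sum.\<close>

lemma moment_bounded_1: "moment_bounded 1"
proof -
  have "moment_bounded (0 + 2)"
    using k_ge_2 by (intro moment_bounded_step moment_bounded_0) simp
  then obtain C where C: "C \<ge> 0"
    "\<And>b N. expectation (\<lambda>\<omega>. lin_sum b N \<omega> ^ 2) \<le> C * sqrt (\<Sum>s<N. (b s)\<^sup>2) ^ 2"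
    unfolding moment_bounded_def add_0 power2_abs by blast
  have "expectation (\<lambda>\<omega>. \<bar>lin_sum b N \<omega>\<bar> ^ 1) \<le> (C + 1) * sqrt (\<Sum>s<N. (b s)\<^sup>2) ^ 1" for b N
  proof -
    define R where "R = sqrt (\<Sum>s<N. (b s)\<^sup>2)"
    show ?thesis
    proof (cases "R = 0")
      case True
      then have "\<forall>s<N. b s = 0"
        by (simp add: R_def sum_nonneg_eq_0_iff)
      then show ?thesis
        by (simp add: lin_sum_def)
    next
      case False
      moreover have "R \<ge> 0" by (simp add: R_def sum_nonneg)
      ultimately have R: "R > 0" by simp
      have i2: "integrable M (\<lambda>\<omega>. lin_sum b N \<omega> ^ 2)"
        using k_ge_2 by (intro integrable_lin_sum_power) auto
      have "expectation (\<lambda>\<omega>. \<bar>lin_sum b N \<omega>\<bar>) \<le> expectation (\<lambda>\<omega>. lin_sum b N \<omega> ^ 2 / R + R)"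
      proof (rule integral_mono)
        show "integrable M (\<lambda>\<omega>. \<bar>lin_sum b N \<omega>\<bar>)"
          using integrable_abs_lin_sum_power[of 1 b N] k_ge_2 by simp
        fix \<omega>
        have "\<bar>x\<bar> \<le> x\<^sup>2 / R + R" for x :: real
        proof (cases "\<bar>x\<bar> \<le> R")
          case True
          moreover have "0 \<le> x\<^sup>2 / R" using R by simp
          ultimately show ?thesis by linarith
        next
          case False
          then have "R * \<bar>x\<bar> \<le> \<bar>x\<bar> * \<bar>x\<bar>" by (intro mult_right_mono) auto
          then have "\<bar>x\<bar> \<le> x\<^sup>2 / R" using R by (simp add: field_simps power2_eq_square)
          then show ?thesis using R by linarith
        qed
        then show "\<bar>lin_sum b N \<omega>\<bar> \<le> lin_sum b N \<omega> ^ 2 / R + R" .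
      qed (use i2 in simp)
      also have "\<dots> = expectation (\<lambda>\<omega>. lin_sum b N \<omega> ^ 2) / R + R"
        using i2 by (simp add: prob_space)
      also have "\<dots> \<le> C * R\<^sup>2 / R + R"
        using C(2)[of b N] R by (simp add: R_def divide_right_mono)
      also have "\<dots> = (C + 1) * R"
        using R by (simp add: power2_eq_square algebra_simps)
      finally show ?thesis by (simp add: R_def)
    qed
  qed
  then show ?thesis
    unfolding moment_bounded_def using C(1) by (intro exI[of _ "C + 1"]) auto
qed

lemma moment_bounded: "q \<le> k \<Longrightarrow> moment_bounded q"
proof (induction q rule: less_induct)
  case (less q)
  consider "q = 0" | "q = 1" | r where "q = r + 2"
    by (metis One_nat_def add_2_eq_Suc' nat.exhaust)
  then show ?case
    using less moment_bounded_0 moment_bounded_1 moment_bounded_step by cases auto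
qed

text \<open>The uniform moment bound and Fatou's lemma control the distance from \<open>S\<close> to
  its partial sums in the mean of order \<open>q\<close> by the l2 tail \<open>r N\<close> of the
  coefficients.\<close>

lemma tendsto_expectation_lin_sum:
  assumes b2: "summable (\<lambda>s. (b s)\<^sup>2)" and q: "q \<le> k"
    and [measurable]: "S \<in> borel_measurable M"
    and S: "AE \<omega> in M. (\<lambda>s. b s * e s \<omega>) sums S \<omega>"
  shows "(\<lambda>N. expectation (\<lambda>\<omega>. lin_sum b N \<omega> ^ q)) \<longlonglongrightarrow> expectation (\<lambda>\<omega>. S \<omega> ^ q)"
proof -
  obtain C where C: "C \<ge> 0"
    "\<And>b N. expectation (\<lambda>\<omega>. \<bar>lin_sum b N \<omega>\<bar> ^ q) \<le> C * sqrt (\<Sum>s<N. (b s)\<^sup>2) ^ q"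
    using moment_bounded[OF q] unfolding moment_bounded_def by blast
  define r where "r N = sqrt (\<Sum>s. (b (s + N))\<^sup>2)" for N
  have lim: "AE \<omega> in M. (\<lambda>m. lin_sum b m \<omega>) \<longlonglongrightarrow> S \<omega>"
    using S by (simp add: sums_def lin_sum_def)
  have tail: "integrable M (\<lambda>\<omega>. \<bar>S \<omega> - lin_sum b N \<omega>\<bar> ^ q) \<and>
      expectation (\<lambda>\<omega>. \<bar>S \<omega> - lin_sum b N \<omega>\<bar> ^ q) \<le> C * r N ^ q" for N
  proof -
    \<comment> \<open>Deleting the first \<open>N\<close> coefficients makes the difference of two
      partial sums a linear combination again, to which the uniform bound applies.\<close>
    define b' where "b' s = (if s < N then 0 else b s)" for s
    have eq: "lin_sum b m \<omega> - lin_sum b N \<omega> = lin_sum b' m \<omega>" if "m \<ge> N" for m \<omega>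
    proof -
      have "lin_sum b m \<omega> = (\<Sum>s<N. b s * e s \<omega>) + (\<Sum>s=N..<m. b s * e s \<omega>)"
        using that by (simp add: lin_sum_def lessThan_atLeast0 sum.atLeastLessThan_concat)
      moreover have "lin_sum b' m \<omega> = (\<Sum>s<N. b' s * e s \<omega>) + (\<Sum>s=N..<m. b' s * e s \<omega>)"
        using that by (simp add: lin_sum_def lessThan_atLeast0 sum.atLeastLessThan_concat)
      ultimately show ?thesis by (simp add: lin_sum_def b'_def)
    qed
    have int: "integrable M (\<lambda>\<omega>. \<bar>lin_sum b m \<omega> + (-1) * lin_sum b N \<omega>\<bar> ^ q)" for m
      using q by (intro integrable_abs_power_add integrable_abs_lin_sum_power)
        (auto simp: integrable_abs_lin_sum_power)
    then have int: "integrable M (\<lambda>\<omega>. \<bar>lin_sum b m \<omega> - lin_sum b N \<omega>\<bar> ^ q)" for m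
      by simp
    have bd: "expectation (\<lambda>\<omega>. \<bar>lin_sum b m \<omega> - lin_sum b N \<omega>\<bar> ^ q) \<le> C * r N ^ q" if "m \<ge> N" for m
    proof -
      have "expectation (\<lambda>\<omega>. \<bar>lin_sum b m \<omega> - lin_sum b N \<omega>\<bar> ^ q) \<le> C * sqrt (\<Sum>s<m. (b' s)\<^sup>2) ^ q"
        unfolding eq[OF that] by (rule C(2))
      also have "(\<Sum>s<m. (b' s)\<^sup>2) = (\<Sum>s<N. (b' s)\<^sup>2) + (\<Sum>s=N..<m. (b' s)\<^sup>2)"
        using that by (simp add: lessThan_atLeast0 sum.atLeastLessThan_concat)
      also have "\<dots> = (\<Sum>s=N..<m. (b s)\<^sup>2)"
        by (simp add: b'_def)
      also have "\<dots> = (\<Sum>s<m - N. (b (s + N))\<^sup>2)"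
        using sum.shift_bounds_nat_ivl[of "\<lambda>s. (b s)\<^sup>2" 0 N "m - N"] that
        by (simp add: lessThan_atLeast0)
      also have "C * sqrt \<dots> ^ q \<le> C * r N ^ q"
        unfolding r_def using C(1) summable_iff_shift[of "\<lambda>s. (b s)\<^sup>2" N] b2
        by (intro mult_left_mono power_mono real_sqrt_le_mono sum_le_suminf) (auto simp: sum_nonneg)
      finally show ?thesis .
    qed
    have "AE \<omega> in M. (\<lambda>m. \<bar>lin_sum b m \<omega> - lin_sum b N \<omega>\<bar> ^ q) \<longlonglongrightarrow> \<bar>S \<omega> - lin_sum b N \<omega>\<bar> ^ q"
      using lim by eventually_elim (intro tendsto_intros)
    from fatou_integral[OF int _ _ this bd] show ?thesis by auto
  qed
  from integrable_abs_power_add[OF _ _ conjunct1[OF tail[of 0]] integrable_abs_lin_sum_power[OF q, of b 0]]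
  have iS: "integrable M (\<lambda>\<omega>. \<bar>S \<omega>\<bar> ^ q)" by simp
  have rq: "(\<lambda>N. C * r N ^ q) \<longlonglongrightarrow> 0" if "q > 0"
  proof -
    have "r \<longlonglongrightarrow> sqrt 0"
      unfolding r_def by (intro tendsto_real_sqrt suminf_exist_split2[OF b2])
    then have "(\<lambda>N. C * r N ^ q) \<longlonglongrightarrow> C * 0 ^ q"
      by (intro tendsto_intros) simp
    then show ?thesis using that by (simp only: zero_power mult_zero_right)
  qed
  show "(\<lambda>N. expectation (\<lambda>\<omega>. lin_sum b N \<omega> ^ q)) \<longlonglongrightarrow> expectation (\<lambda>\<omega>. S \<omega> ^ q)"
  \<comment> \<open>Separate because \<open>r N ^ 0 = 1\<close> does not tend to 0.\<close>
  proof (cases "q = 0")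
    case False
    then have q0: "q > 0" by simp
    define A where "A = expectation (\<lambda>\<omega>. \<bar>S \<omega>\<bar> ^ q)"
    have A: "A \<ge> 0" unfolding A_def by (intro Bochner_Integration.integral_nonneg) auto
    show ?thesis
    proof (rule LIMSEQ_I)
      fix \<epsilon> :: real assume \<epsilon>: "\<epsilon> > 0"
      \<comment> \<open>Makes the first error term at most half of the target; the added 1 keeps the
        denominator positive when \<open>A = 0\<close>.\<close>
      define \<delta> where "\<delta> = \<epsilon> / (2 * (A + 1))"
      have \<delta>: "\<delta> > 0" using A \<epsilon> by (simp add: \<delta>_def)
      obtain D where D: "D \<ge> 0" "\<And>x h::real. \<bar>(x + h) ^ q - x ^ q\<bar> \<le> \<delta> * \<bar>x\<bar> ^ q + D * \<bar>h\<bar> ^ q"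
        using abs_power_diff_le[OF \<delta>, of q] by blast
      have "(\<lambda>N. D * (C * r N ^ q)) \<longlonglongrightarrow> D * 0"
        by (intro tendsto_intros rq q0)
      then have "\<forall>\<^sub>F N in sequentially. D * (C * r N ^ q) < \<epsilon> / 2"
        using \<epsilon> by (intro order_tendstoD) auto
      then obtain N0 where N0: "\<And>N. N \<ge> N0 \<Longrightarrow> D * (C * r N ^ q) < \<epsilon> / 2"
        by (auto simp: eventually_sequentially)
      show "\<exists>N0. \<forall>N\<ge>N0. norm (expectation (\<lambda>\<omega>. lin_sum b N \<omega> ^ q) - expectation (\<lambda>\<omega>. S \<omega> ^ q)) < \<epsilon>"
      proof (intro exI allI impI)
        fix N assume N: "N \<ge> N0"
        have iT: "integrable M (\<lambda>\<omega>. lin_sum b N \<omega> ^ q)"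
          by (rule integrable_lin_sum_power[OF q])
        have iS': "integrable M (\<lambda>\<omega>. S \<omega> ^ q)"
          by (rule integrable_power_of_abs[OF _ iS]) simp
        have "norm (expectation (\<lambda>\<omega>. lin_sum b N \<omega> ^ q) - expectation (\<lambda>\<omega>. S \<omega> ^ q)) =
            norm (expectation (\<lambda>\<omega>. lin_sum b N \<omega> ^ q - S \<omega> ^ q))"
          using iT iS' by simp
        also have "\<dots> \<le> expectation (\<lambda>\<omega>. norm (lin_sum b N \<omega> ^ q - S \<omega> ^ q))"
          by (rule integral_norm_bound)
        also have "\<dots> \<le> expectation (\<lambda>\<omega>. \<delta> * \<bar>S \<omega>\<bar> ^ q + D * \<bar>S \<omega> - lin_sum b N \<omega>\<bar> ^ q)"
        proof (rule integral_mono)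
          fix \<omega>
          show "norm (lin_sum b N \<omega> ^ q - S \<omega> ^ q) \<le> \<delta> * \<bar>S \<omega>\<bar> ^ q + D * \<bar>S \<omega> - lin_sum b N \<omega>\<bar> ^ q"
            using D(2)[of "S \<omega>" "lin_sum b N \<omega> - S \<omega>"] by (simp add: abs_minus_commute)
        qed (use iT iS iS' tail[of N] in auto)
        also have "\<dots> = \<delta> * A + D * expectation (\<lambda>\<omega>. \<bar>S \<omega> - lin_sum b N \<omega>\<bar> ^ q)"
          using iS tail[of N] by (simp add: A_def)
        also have "\<dots> \<le> \<delta> * A + D * (C * r N ^ q)"
          using D(1) tail[of N] by (intro add_left_mono mult_left_mono) auto
        also have "\<delta> * A \<le> \<epsilon> / 2"
        proof -
          have "\<delta> * A \<le> \<delta> * (A + 1)" using \<delta> by simp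
          also have "\<dots> = \<epsilon> / 2" using A by (simp add: \<delta>_def field_simps)
          finally show ?thesis .
        qed
        finally show "norm (expectation (\<lambda>\<omega>. lin_sum b N \<omega> ^ q) - expectation (\<lambda>\<omega>. S \<omega> ^ q)) < \<epsilon>"
          using N0[OF N] by linarith
      qed
    qed
  qed simp
qed

text \<open>The term \<open>i = 0\<close> must be dropped before the limit is taken: the plain sum
  of the coefficients may diverge, and in the finite identity it is multiplied by
  \<open>L 0 = 0\<close>. All other power sums have order at least 2 and converge.\<close>

lemma series_moment_recurrence:
  assumes b2: "summable (\<lambda>s. (b s)\<^sup>2)" and q: "Suc q \<le> k"
    and [measurable]: "S \<in> borel_measurable M"
    and S: "AE \<omega> in M. (\<lambda>s. b s * e s \<omega>) sums S \<omega>"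
  shows "real (Suc q) * (expectation (\<lambda>\<omega>. S \<omega> ^ Suc q) / fact (Suc q)) =
    (\<Sum>i=1..q. fps_nth (log_deriv_fps \<mu>) i * (\<Sum>s. b s ^ Suc i) *
      (expectation (\<lambda>\<omega>. S \<omega> ^ (q - i)) / fact (q - i)))"
proof -
  note lim = tendsto_expectation_lin_sum[OF b2 _ _ S]
  have "(\<lambda>N. real (Suc q) * (expectation (\<lambda>\<omega>. lin_sum b N \<omega> ^ Suc q) / fact (Suc q)))
      \<longlonglongrightarrow> real (Suc q) * (expectation (\<lambda>\<omega>. S \<omega> ^ Suc q) / fact (Suc q))"
    using q by (intro tendsto_intros lim) auto
  moreover have "real (Suc q) * (expectation (\<lambda>\<omega>. lin_sum b N \<omega> ^ Suc q) / fact (Suc q)) =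
    (\<Sum>i=1..q. fps_nth (log_deriv_fps \<mu>) i * (\<Sum>s<N. b s ^ Suc i) *
      (expectation (\<lambda>\<omega>. lin_sum b N \<omega> ^ (q - i)) / fact (q - i)))" for N
    unfolding lin_sum_moment_recurrence[OF q]
    by (rule sum.mono_neutral_right) (auto simp: log_deriv_fps_nth not_le)
  moreover have "(\<lambda>N. \<Sum>i=1..q. fps_nth (log_deriv_fps \<mu>) i * (\<Sum>s<N. b s ^ Suc i) *
      (expectation (\<lambda>\<omega>. lin_sum b N \<omega> ^ (q - i)) / fact (q - i))) \<longlonglongrightarrow>
    (\<Sum>i=1..q. fps_nth (log_deriv_fps \<mu>) i * (\<Sum>s. b s ^ Suc i) *
      (expectation (\<lambda>\<omega>. S \<omega> ^ (q - i)) / fact (q - i)))"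
  proof (intro tendsto_sum tendsto_mult tendsto_divide tendsto_const lim)
    fix i assume "i \<in> {1..q}"
    then have "summable (\<lambda>s. \<bar>b s ^ Suc i\<bar>)"
      using summable_power_ge_2[OF b2, of "Suc i"] by (auto simp only: power_abs atLeastAtMost_iff)
    then show "(\<lambda>N. \<Sum>s<N. b s ^ Suc i) \<longlonglongrightarrow> (\<Sum>s. b s ^ Suc i)"
      by (rule summable_LIMSEQ[OF summable_rabs_cancel])
  qed (use q in auto)
  ultimately show ?thesis
    using LIMSEQ_unique by simp
qed

end

section \<open>Power sums of the coefficients\<close>

text \<open>Used with unit weights under short memory and with the increments of
  \<open>N powr d\<close> under long memory.\<close>

lemma weighted_cesaro:
  fixes w x :: "nat \<Rightarrow> real"
  assumes w: "\<And>i. 0 \<le> w i" and W: "filterlim (\<lambda>N. \<Sum>i<N. w i) at_top sequentially"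
    and x: "x \<longlonglongrightarrow> l"
  shows "(\<lambda>N. (\<Sum>i<N. w i * x i) / (\<Sum>i<N. w i)) \<longlonglongrightarrow> l"
proof (rule LIMSEQ_I)
  fix r :: real assume r: "r > 0"
  obtain N0 where N0: "\<And>i. i \<ge> N0 \<Longrightarrow> \<bar>x i - l\<bar> < r / 2"
    using LIMSEQ_D[OF x, of "r / 2"] r by auto
  \<comment> \<open>The fixed contribution of the initial terms; total weight above
    \<open>2 * K / r\<close> makes it less than half of the allowed error.\<close>
  define K where "K = (\<Sum>i<N0. w i * \<bar>x i - l\<bar>)"
  have K: "K \<ge> 0" unfolding K_def by (intro sum_nonneg) (simp add: w)
  have "\<forall>\<^sub>F N in sequentially. (\<Sum>i<N. w i) > 2 * K / r"
    using W by (simp add: filterlim_at_top_dense)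
  then obtain N1 where N1: "\<And>N. N \<ge> N1 \<Longrightarrow> (\<Sum>i<N. w i) > 2 * K / r"
    by (auto simp: eventually_sequentially)
  show "\<exists>N0. \<forall>N\<ge>N0. norm ((\<Sum>i<N. w i * x i) / (\<Sum>i<N. w i) - l) < r"
  proof (intro exI allI impI)
    fix N assume N: "N \<ge> max N0 N1"
    define V where "V = (\<Sum>i<N. w i)"
    have V: "V > 2 * K / r" using N1[of N] N by (simp add: V_def)
    moreover have "2 * K / r \<ge> 0" using K r by simp
    ultimately have V0: "V > 0" by linarith
    have "\<bar>\<Sum>i<N. w i * (x i - l)\<bar> \<le> (\<Sum>i<N. w i * \<bar>x i - l\<bar>)"
      by (rule order_trans[OF sum_abs]) (simp add: abs_mult w)
    also have "\<dots> = K + (\<Sum>i=N0..<N. w i * \<bar>x i - l\<bar>)"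
      using N by (simp add: K_def lessThan_atLeast0 sum.atLeastLessThan_concat)
    also have "(\<Sum>i=N0..<N. w i * \<bar>x i - l\<bar>) \<le> (\<Sum>i=N0..<N. w i * (r / 2))"
      using N0 w by (intro sum_mono mult_left_mono) (auto intro: less_imp_le)
    also have "\<dots> \<le> (\<Sum>i<N. w i * (r / 2))"
      using w r by (intro sum_mono2) auto
    also have "\<dots> = V * (r / 2)"
      by (simp only: V_def sum_distrib_right)
    also have "K < V * (r / 2)"
      using V r by (simp add: field_simps)
    finally have "\<bar>\<Sum>i<N. w i * (x i - l)\<bar> < V * r"
      by (simp add: field_simps)
    moreover have "(\<Sum>i<N. w i * (x i - l)) = (\<Sum>i<N. w i * x i) - l * V"
      by (simp add: V_def right_diff_distrib sum_subtractf sum_distrib_left mult.commute)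
    moreover have "(\<Sum>i<N. w i * x i) / V - l = ((\<Sum>i<N. w i * x i) - l * V) / V"
      using V0 by (simp add: field_simps)
    ultimately have "\<bar>(\<Sum>i<N. w i * x i) / V - l\<bar> < V * r / V"
      using V0 by (simp only: abs_divide abs_of_pos divide_strict_right_mono)
    then show "norm ((\<Sum>i<N. w i * x i) / (\<Sum>i<N. w i) - l) < r"
      using V0 by (simp add: V_def)
  qed
qed

lemma cesaro:
  fixes x :: "nat \<Rightarrow> real"
  assumes "x \<longlonglongrightarrow> l"
  shows "(\<lambda>n. (\<Sum>i<n. x i) / real n) \<longlonglongrightarrow> l"
  using weighted_cesaro[of "\<lambda>_. 1", OF _ _ assms] by (simp add: filterlim_real_sequentially)

section \<open>Coefficients of the partial sums of the process\<close>

definition coeff_sum :: "(nat \<Rightarrow> real) \<Rightarrow> nat \<Rightarrow> real" where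
  "coeff_sum a N = (\<Sum>i<N. a i)"

text \<open>The coefficient of \<open>\<epsilon> (n - s)\<close> in \<open>X 1 + \<dots> + X n\<close>; for \<open>s < n\<close> the truncated subtraction
  makes the second term vanish.\<close>

definition block_coeff :: "(nat \<Rightarrow> real) \<Rightarrow> nat \<Rightarrow> nat \<Rightarrow> real" where
  "block_coeff a n s = coeff_sum a (Suc s) - coeff_sum a (Suc s - n)"

lemma block_coeff_0: "block_coeff a 0 s = 0"
  by (simp add: block_coeff_def)

lemma block_coeff_Suc:
  "block_coeff a (Suc n) s = block_coeff a n s + (if n \<le> s then a (s - n) else 0)"
  by (auto simp: block_coeff_def coeff_sum_def Suc_diff_le)

lemma block_coeff_eq_sum:
  "block_coeff a n s = (\<Sum>i=Suc s - n..<Suc s. a i)"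
  using sum.atLeastLessThan_concat[of 0 "Suc s - n" "Suc s" a]
  unfolding block_coeff_def coeff_sum_def lessThan_atLeast0 by linarith

text \<open>With \<open>x s = \<epsilon> (n - s)\<close> the inner series is
  \<open>X (n - r)\<close>. Padding it with \<open>r\<close> leading zeros aligns the finitely many
  series, so ordinary convergence of each suffices.\<close>

lemma sums_block_coeff:
  assumes "\<And>r. r < n \<Longrightarrow> summable (\<lambda>i. a i * x (i + r))"
  shows "(\<lambda>s. block_coeff a n s * x s) sums (\<Sum>r<n. \<Sum>i. a i * x (i + r))"
  using assms
proof (induction n)
  case (Suc n)
  have "(\<lambda>s. (if n \<le> s then a (s - n) else 0) * x s) sums (\<Sum>i. a i * x (i + n))"
    using summable_sums[OF Suc.prems[of n]]
    by (subst sums_zero_iff_shift[of n, symmetric]) auto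
  from sums_add[OF Suc.IH this] show ?case
    using Suc.prems by (simp add: block_coeff_Suc distrib_right)
qed (simp add: block_coeff_0)

lemma summable_block_coeff_square:
  assumes "summable (\<lambda>i. (a i)\<^sup>2)"
  shows "summable (\<lambda>s. (block_coeff a n s)\<^sup>2)"
proof (induction n)
  case (Suc n)
  have "summable (\<lambda>s. (if n \<le> s then a (s - n) else 0)\<^sup>2)"
    using assms by (subst summable_iff_shift[of _ n, symmetric]) simp
  then have "summable (\<lambda>s. 2 * (block_coeff a n s)\<^sup>2 + 2 * (if n \<le> s then a (s - n) else 0)\<^sup>2)"
    using Suc by (intro summable_add summable_mult)
  then show ?case
  proof (rule summable_comparison_test')
    fix s :: nat
    have "(u + v)\<^sup>2 \<le> 2 * u\<^sup>2 + 2 * v\<^sup>2" for u v :: real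
      using sum_squares_ge_zero[of "u - v" 0] by (simp add: power2_eq_square algebra_simps)
    then show "norm ((block_coeff a (Suc n) s)\<^sup>2) \<le>
        2 * (block_coeff a n s)\<^sup>2 + 2 * (if n \<le> s then a (s - n) else 0)\<^sup>2"
      unfolding block_coeff_Suc by simp
  qed
qed (simp add: block_coeff_0)

text \<open>For \<open>s < n\<close> the coefficients are partial sums of \<open>a\<close>, whose
  powers have a Cesaro limit. For \<open>s \<ge> n\<close> all but one factor is bounded by
  \<open>B\<close>, and summing the last factor gives \<open>n\<close> tails of the absolute series,
  whose average tends to 0.\<close>

lemma power_sum_asymptotics_short_memory:
  assumes a: "summable (\<lambda>i. \<bar>a i\<bar>)" and q: "q \<ge> 2"
  shows "(\<lambda>n. (\<Sum>s. block_coeff a n s ^ q) / real n) \<longlonglongrightarrow> (\<Sum>i. a i) ^ q"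
proof -
  define B where "B = (\<Sum>i. \<bar>a i\<bar>)"
  have B0: "B \<ge> 0"
    unfolding B_def by (rule suminf_nonneg[OF a]) simp
  have coeff_sum_lim: "coeff_sum a \<longlonglongrightarrow> (\<Sum>i. a i)"
    using summable_LIMSEQ[OF summable_rabs_cancel[OF a]] by (simp add: coeff_sum_def[abs_def])
  have a2: "summable (\<lambda>i. (a i)\<^sup>2)"
  proof (rule summable_comparison_test_ev[OF _ a])
    have "\<forall>\<^sub>F i in sequentially. \<bar>a i\<bar> < 1"
      using summable_LIMSEQ_zero[OF a] by (rule order_tendstoD) simp
    then show "\<forall>\<^sub>F i in sequentially. norm ((a i)\<^sup>2) \<le> \<bar>a i\<bar>"
    proof eventually_elim
      case (elim i)
      then have "\<bar>a i\<bar> * \<bar>a i\<bar> \<le> \<bar>a i\<bar> * 1" by (intro mult_left_mono) auto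
      then show ?case by (simp add: power2_eq_square abs_mult)
    qed
  qed
  define R where "R j = (\<Sum>i. \<bar>a (i + j)\<bar>)" for j
  have sh: "summable (\<lambda>i. \<bar>a (i + j)\<bar>)" for j
    using a summable_iff_shift[of "\<lambda>i. \<bar>a i\<bar>" j] by simp
  have R: "R \<longlonglongrightarrow> 0"
    unfolding R_def by (rule suminf_exist_split2[OF a])
  have ssum: "summable (\<lambda>s. block_coeff a n s ^ q)" for n
    using summable_power_ge_2[OF summable_block_coeff_square[OF a2, of n] q]
    by (simp add: summable_rabs_cancel power_abs)
  have "(\<lambda>n. (\<Sum>s<n. coeff_sum a (Suc s) ^ q) / real n) \<longlonglongrightarrow> (\<Sum>i. a i) ^ q"
    by (intro cesaro tendsto_power LIMSEQ_Suc coeff_sum_lim)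
  moreover have "(\<lambda>n. (\<Sum>s. block_coeff a n (s + n) ^ q) / real n) \<longlonglongrightarrow> 0"
  proof (rule Lim_null_comparison)
    have "(\<lambda>n. (\<Sum>r<n. R (Suc r)) / real n) \<longlonglongrightarrow> 0"
      by (intro cesaro LIMSEQ_Suc R)
    then have "(\<lambda>n. B ^ (q - 1) * ((\<Sum>r<n. R (Suc r)) / real n)) \<longlonglongrightarrow> B ^ (q - 1) * 0"
      by (intro tendsto_mult tendsto_const)
    then show "(\<lambda>n. B ^ (q - 1) * ((\<Sum>r<n. R (Suc r)) / real n)) \<longlonglongrightarrow> 0"
      by (simp only: mult_zero_right)
    have "norm ((\<Sum>s. block_coeff a n (s + n) ^ q) / real n) \<le> B ^ (q - 1) * ((\<Sum>r<n. R (Suc r)) / real n)" for n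
    proof -
      have le1: "\<bar>block_coeff a n (s + n)\<bar> \<le> (\<Sum>r<n. \<bar>a (s + Suc r)\<bar>)" for s
      proof -
        have "block_coeff a n (s + n) = (\<Sum>r<n. a (s + Suc r))"
        proof -
          have "block_coeff a n (s + n) = (\<Sum>i=0 + Suc s..<n + Suc s. a i)"
            by (simp add: block_coeff_eq_sum add.commute[of s n])
          also have "\<dots> = (\<Sum>r=0..<n. a (r + Suc s))"
            by (rule sum.shift_bounds_nat_ivl)
          finally show ?thesis
            by (simp add: lessThan_atLeast0 add_ac)
        qed
        then show ?thesis by (simp only: sum_abs)
      qed
      have le2: "(\<Sum>r<n. \<bar>a (s + Suc r)\<bar>) \<le> B" for s
      proof -
        have "(\<Sum>r<n. \<bar>a (s + Suc r)\<bar>) = (\<Sum>i=Suc s..<Suc s + n. \<bar>a i\<bar>)"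
        proof -
          have "(\<Sum>i=0 + Suc s..<n + Suc s. \<bar>a i\<bar>) = (\<Sum>r=0..<n. \<bar>a (r + Suc s)\<bar>)"
            by (rule sum.shift_bounds_nat_ivl)
          then show ?thesis
            by (simp add: lessThan_atLeast0 add_ac)
        qed
        also have "\<dots> \<le> B"
          unfolding B_def by (intro sum_le_suminf[OF a]) auto
        finally show ?thesis .
      qed
      have le: "norm (block_coeff a n (s + n) ^ q) \<le> B ^ (q - 1) * (\<Sum>r<n. \<bar>a (s + Suc r)\<bar>)" for s
      proof -
        have "\<bar>block_coeff a n (s + n)\<bar> ^ (q - 1) \<le> B ^ (q - 1)"
          using le1[of s] le2[of s] by (intro power_mono) auto
        then have "\<bar>block_coeff a n (s + n)\<bar> ^ (q - 1) * \<bar>block_coeff a n (s + n)\<bar> \<le>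
            B ^ (q - 1) * (\<Sum>r<n. \<bar>a (s + Suc r)\<bar>)"
          using le1[of s] B0 by (intro mult_mono) auto
        also have "\<bar>block_coeff a n (s + n)\<bar> ^ (q - 1) * \<bar>block_coeff a n (s + n)\<bar> = \<bar>block_coeff a n (s + n)\<bar> ^ q"
          using q by (cases q) auto
        finally show ?thesis by (simp add: power_abs)
      qed
      have sums: "(\<lambda>s. \<Sum>r<n. \<bar>a (s + Suc r)\<bar>) sums (\<Sum>r<n. R (Suc r))"
        unfolding R_def by (intro sums_sum summable_sums sh)
      have "norm (\<Sum>s. block_coeff a n (s + n) ^ q) \<le> (\<Sum>s. B ^ (q - 1) * (\<Sum>r<n. \<bar>a (s + Suc r)\<bar>))"
        by (rule norm_suminf_le[OF le]) (intro summable_mult sums_summable[OF sums])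
      also have "\<dots> = B ^ (q - 1) * (\<Sum>r<n. R (Suc r))"
        using sums by (subst suminf_mult) (auto simp: sums_iff)
      finally show ?thesis
        by (simp add: divide_right_mono)
    qed
    then show "\<forall>\<^sub>F n in sequentially. norm ((\<Sum>s. block_coeff a n (s + n) ^ q) / real n) \<le>
        B ^ (q - 1) * ((\<Sum>r<n. R (Suc r)) / real n)"
      by (intro always_eventually) blast
  qed
  ultimately have "(\<lambda>n. (\<Sum>s<n. coeff_sum a (Suc s) ^ q) / real n + (\<Sum>s. block_coeff a n (s + n) ^ q) / real n)
      \<longlonglongrightarrow> (\<Sum>i. a i) ^ q + 0"
    by (rule tendsto_add)
  moreover have "(\<Sum>s. block_coeff a n s ^ q) =
      (\<Sum>s<n. coeff_sum a (Suc s) ^ q) + (\<Sum>s. block_coeff a n (s + n) ^ q)" for n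
  proof -
    have "(\<Sum>s<n. block_coeff a n s ^ q) = (\<Sum>s<n. coeff_sum a (Suc s) ^ q)"
      by (intro sum.cong) (auto simp: block_coeff_def coeff_sum_def)
    then show ?thesis
      using suminf_split_initial_segment[OF ssum, of n n] by simp
  qed
  ultimately show ?thesis
    by (simp add: add_divide_distrib)
qed

text \<open>The weights \<open>w i\<close> telescope to \<open>N powr d\<close> and satisfy
  \<open>w i ~ d i powr (d - 1)\<close>, so \<open>a i / w i\<close> tends to \<open>c / d\<close>
  and the weighted Cesaro limit applies.\<close>

lemma coeff_sum_asymptotics:
  assumes "long_memory a d c"
  shows "(\<lambda>N. coeff_sum a N / real N powr d) \<longlonglongrightarrow> c / d"
proof -
  have d: "0 < d" "d < 1" and c: "c > 0" and a: "a \<sim>[sequentially] (\<lambda>i. c * real i powr (d - 1))"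
    using assms by (auto simp: long_memory_def)
  define w where "w i = real (Suc i) powr d - real i powr d" for i
  have w: "0 < w i" for i
    unfolding w_def using d by (simp add: powr_less_mono2)
  have sum_w: "(\<Sum>i<N. w i) = real N powr d" for N
    unfolding w_def using d by (subst sum_lessThan_telescope) simp
  have "(\<lambda>i. a i / (c * real i powr (d - 1))) \<longlonglongrightarrow> 1"
  proof (rule asymp_equivD_strong[OF a])
    show "\<forall>\<^sub>F i in sequentially. a i \<noteq> 0 \<or> c * real i powr (d - 1) \<noteq> 0"
      using eventually_gt_at_top[of 0] by eventually_elim (use c in auto)
  qed
  moreover have "(\<lambda>i. c * real i powr (d - 1) / w i) \<longlonglongrightarrow> c / d"
  proof -
    have "(\<lambda>i. real i powr (d - 1) / w i) \<longlonglongrightarrow> inverse d"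
      unfolding w_def using d by real_asymp
    from tendsto_mult_left[OF this, of c] show ?thesis
      by (simp add: divide_inverse mult.assoc)
  qed
  ultimately have "(\<lambda>i. a i / (c * real i powr (d - 1)) * (c * real i powr (d - 1) / w i)) \<longlonglongrightarrow> 1 * (c / d)"
    by (rule tendsto_mult)
  moreover have "\<forall>\<^sub>F i in sequentially. a i / (c * real i powr (d - 1)) * (c * real i powr (d - 1) / w i) = a i / w i"
    using eventually_gt_at_top[of 0] by eventually_elim (use c in auto)
  ultimately have "(\<lambda>i. a i / w i) \<longlonglongrightarrow> 1 * (c / d)"
    by (rule Lim_transform_eventually)
  then have "(\<lambda>i. a i / w i) \<longlonglongrightarrow> c / d"
    by (simp only: mult_1)
  then have "(\<lambda>N. (\<Sum>i<N. w i * (a i / w i)) / (\<Sum>i<N. w i)) \<longlonglongrightarrow> c / d"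
  proof (rule weighted_cesaro[rotated 2])
    show "filterlim (\<lambda>N. \<Sum>i<N. w i) at_top sequentially"
      unfolding sum_w using d by real_asymp
  qed (simp add: w less_imp_le)
  moreover have "w i * (a i / w i) = a i" for i
    using w[of i] by simp
  ultimately show ?thesis
    by (simp add: sum_w coeff_sum_def)
qed

text \<open>Writes a sum as the integral of a step function, which makes dominated convergence
  available. Rounding down sends Lebesgue measure on the half-line to counting measure, as each cell
  has length 1; scaling by \<open>c\<close> then divides by \<open>c\<close>.\<close>

lemma LBINT_nat_floor:
  fixes F :: "nat \<Rightarrow> real"
  assumes "summable (\<lambda>s. \<bar>F s\<bar>)" and c: "c > 0"
  shows "(LBINT x. indicator {0..} x * F (nat \<lfloor>c * x\<rfloor>)) = (\<Sum>s. F s) / c"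
proof -
  let ?R = "restrict_space lborel {0::real..}"
  let ?g = "\<lambda>x::real. nat \<lfloor>x\<rfloor>"
  have g [measurable]: "?g \<in> measurable ?R (count_space UNIV)"
    by (intro measurable_restrict_space1) measurable
  have "distr ?R (count_space UNIV) ?g = count_space UNIV"
  proof (rule measure_eqI_countable[where A = UNIV])
    fix s :: nat
    have "emeasure (distr ?R (count_space UNIV) ?g) {s} = emeasure ?R (?g -` {s} \<inter> space ?R)"
      by (subst emeasure_distr) auto
    also have "?g -` {s} \<inter> space ?R = {real s..<real s + 1}"
      by (auto simp: space_restrict_space) linarith+
    also have "emeasure ?R {real s..<real s + 1} = emeasure lborel {real s..<real s + 1}"
      by (rule emeasure_restrict_space) auto
    also have "\<dots> = 1" by simp
    finally show "emeasure (distr ?R (count_space UNIV) ?g) {s} = emeasure (count_space UNIV) {s}"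
      by simp
  qed auto
  then have "integral\<^sup>L (count_space UNIV) F = integral\<^sup>L (distr ?R (count_space UNIV) ?g) F"
    by simp
  also have "\<dots> = integral\<^sup>L ?R (\<lambda>x. F (?g x))"
    by (rule integral_distr[OF g]) simp
  also have "\<dots> = (LBINT x. indicator {0..} x * F (?g x))"
    by (subst integral_restrict_space) auto
  also have "\<dots> = \<bar>c\<bar> *\<^sub>R (LBINT x. indicator {0..} (0 + c * x) * F (?g (0 + c * x)))"
    using c by (intro lborel_integral_real_affine) simp
  also have "\<dots> = c * (LBINT x. indicator {0..} x * F (nat \<lfloor>c * x\<rfloor>))"
  proof -
    have "indicator {0..} (c * x) = (indicator {0..} x :: real)" for x
      using c by (auto simp: indicator_def zero_le_mult_iff)
    then show ?thesis using c by simp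
  qed
  finally have "integral\<^sup>L (count_space UNIV) F = c * (LBINT x. indicator {0..} x * F (nat \<lfloor>c * x\<rfloor>))" .
  moreover have "integral\<^sup>L (count_space UNIV) F = (\<Sum>s. F s)"
    using assms by (intro integral_count_space_nat) (simp add: integrable_count_space_nat_iff)
  ultimately show ?thesis
    using c by (simp add: field_simps)
qed

text \<open>Carries the closed gauge integrals of powers over to Lebesgue integrals; nonnegativity
  supplies absolute integrability.\<close>

lemma integrable_lborel_if_has_integral:
  fixes f :: "real \<Rightarrow> real"
  assumes "(f has_integral I) A" and nn: "\<And>x. x \<in> A \<Longrightarrow> 0 \<le> f x"
    and [measurable]: "A \<in> sets borel" "f \<in> borel_measurable borel"
  shows "integrable lborel (\<lambda>x. indicator A x * f x)"
    and "(LBINT x. indicator A x * f x) = I"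
proof -
  have "f absolutely_integrable_on A"
    using assms by (intro nonnegative_absolutely_integrable_1) (auto simp: integrable_on_def)
  then show i: "integrable lborel (\<lambda>x. indicator A x * f x)"
    by (simp add: set_integrable_def integrable_completion)
  then have si: "set_integrable lborel A f"
    by (simp add: set_integrable_def)
  have "(LBINT x:A. f x) = integral A f"
    by (rule set_borel_integral_eq_integral[OF si])
  also have "\<dots> = I"
    using assms(1) by (rule integral_unique)
  finally show "(LBINT x. indicator A x * f x) = I"
    by (simp add: set_lebesgue_integral_def)
qed

lemma coeff_sum_scaled_limit:
  assumes a: "long_memory a d c" and N: "(\<lambda>n. real (N n) / real n) \<longlonglongrightarrow> y" and y: "y > 0"
  shows "(\<lambda>n. coeff_sum a (N n) / real n powr d) \<longlonglongrightarrow> c / d * y powr d"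
proof -
  have d: "d > 0" using a by (simp add: long_memory_def)
  have "filterlim (\<lambda>n. real (N n) / real n * real n) at_top sequentially"
    by (rule filterlim_tendsto_pos_mult_at_top[OF N y filterlim_real_sequentially])
  moreover have "\<forall>\<^sub>F n in sequentially. real (N n) / real n * real n = real (N n)"
    using eventually_gt_at_top[of 0] by eventually_elim simp
  ultimately have "filterlim (\<lambda>n. real (N n)) at_top sequentially"
    by (rule filterlim_mono_eventually[OF _ order_refl order_refl])
  then have "filterlim N at_top sequentially"
    by (simp add: filterlim_sequentially_iff_filterlim_real)
  then have "(\<lambda>n. coeff_sum a (N n) / real (N n) powr d) \<longlonglongrightarrow> c / d"
    by (rule filterlim_compose[OF coeff_sum_asymptotics[OF a]])
  moreover have "(\<lambda>n. (real (N n) / real n) powr d) \<longlonglongrightarrow> y powr d"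
    using y by (intro tendsto_powr N tendsto_const) auto
  ultimately have "(\<lambda>n. coeff_sum a (N n) / real (N n) powr d * (real (N n) / real n) powr d) \<longlonglongrightarrow> c / d * y powr d"
    by (rule tendsto_mult)
  moreover have "\<forall>\<^sub>F n in sequentially. coeff_sum a (N n) / real (N n) powr d * (real (N n) / real n) powr d
      = coeff_sum a (N n) / real n powr d"
    using eventually_gt_at_top[of 0]
  proof eventually_elim
    case (elim n)
    show ?case
    proof (cases "N n = 0")
      case True
      then show ?thesis by (simp add: coeff_sum_def)
    next
      case False
      then show ?thesis using elim by (simp add: powr_divide)
    qed
  qed
  ultimately show ?thesis
    by (rule Lim_transform_eventually)
qed

text \<open>For \<open>x < 1\<close> the second partial sum is eventually empty; for
  \<open>x > 1\<close> its length is asymptotic to \<open>(x - 1) n\<close>. The points 0 and 1 form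
  a null set.\<close>

lemma block_coeff_scaled_limit:
  assumes a: "long_memory a d c" and x: "x > 0" "x \<noteq> 1"
  shows "(\<lambda>n. block_coeff a n (nat \<lfloor>real n * x\<rfloor>) / real n powr d) \<longlonglongrightarrow>
    c / d * (x powr d - (max 0 (x - 1)) powr d)"
proof -
  define N where "N n = Suc (nat \<lfloor>real n * x\<rfloor>)" for n
  have N_bounds: "real n * x \<le> real (N n)" "real (N n) \<le> real n * x + 1" for n
  proof -
    have "real (nat \<lfloor>real n * x\<rfloor>) = of_int \<lfloor>real n * x\<rfloor>" using x by simp
    then show "real n * x \<le> real (N n)" "real (N n) \<le> real n * x + 1"
      unfolding N_def by linarith+
  qed
  have N: "(\<lambda>n. real (N n) / real n) \<longlonglongrightarrow> x"
  proof (rule tendsto_sandwich)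
    show "\<forall>\<^sub>F n in sequentially. x \<le> real (N n) / real n"
      using eventually_gt_at_top[of 0]
    proof eventually_elim
      case (elim n)
      then show ?case using N_bounds(1)[of n] by (simp add: field_simps)
    qed
    show "\<forall>\<^sub>F n in sequentially. real (N n) / real n \<le> x + 1 / real n"
      using eventually_gt_at_top[of 0]
    proof eventually_elim
      case (elim n)
      then show ?case using N_bounds(2)[of n] by (simp add: field_simps)
    qed
    show "(\<lambda>n. x + 1 / real n) \<longlonglongrightarrow> x" by real_asymp
  qed simp
  have "(\<lambda>n. coeff_sum a (N n - n) / real n powr d) \<longlonglongrightarrow> c / d * (max 0 (x - 1)) powr d"
  proof (cases "x > 1")
    case True
    have "(\<lambda>n. real (N n - n) / real n) \<longlonglongrightarrow> x - 1"
    proof (rule Lim_transform_eventually)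
      show "(\<lambda>n. real (N n) / real n - 1) \<longlonglongrightarrow> x - 1"
        by (intro tendsto_intros N)
      show "\<forall>\<^sub>F n in sequentially. real (N n) / real n - 1 = real (N n - n) / real n"
        using eventually_gt_at_top[of 0]
      proof eventually_elim
        case (elim n)
        have "real n * 1 \<le> real n * x" using True by (intro mult_left_mono) auto
        then have "n \<le> N n" using N_bounds(1)[of n] by linarith
        then show ?case using elim by (simp add: of_nat_diff field_simps)
      qed
    qed
    from coeff_sum_scaled_limit[OF a this] True show ?thesis by simp
  next
    case False
    then have x1: "x < 1" using x by simp
    have "\<forall>\<^sub>F n in sequentially. 0 = coeff_sum a (N n - n) / real n powr d"
      using eventually_gt_at_top[of 0]
    proof eventually_elim
      case (elim n)
      then have "real n * x < real n * 1" using x1 by (intro mult_strict_left_mono) auto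
      moreover have "0 \<le> real n * x" using x by simp
      ultimately have "nat \<lfloor>real n * x\<rfloor> < n" using elim by (subst nat_less_iff) (auto simp: floor_less_iff)
      then show ?case by (simp add: N_def coeff_sum_def)
    qed
    then have "(\<lambda>n. coeff_sum a (N n - n) / real n powr d) \<longlonglongrightarrow> 0"
      by (rule Lim_transform_eventually[OF tendsto_const])
    then show ?thesis using x1 by (simp add: max_def)
  qed
  from tendsto_diff[OF coeff_sum_scaled_limit[OF a N x(1)] this]
  show ?thesis
    by (simp add: block_coeff_def N_def diff_divide_distrib right_diff_distrib)
qed

text \<open>For bounded \<open>x\<close> both partial sums are of order \<open>n powr d\<close>. For
  large \<open>x\<close> their difference decays: it has at most \<open>n\<close> terms, all of
  index at least \<open>n x / 2\<close>.\<close>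

lemma block_coeff_dominated:
  assumes a: "long_memory a d c"
  shows "\<exists>C\<ge>0. \<forall>n x. 0 < n \<longrightarrow> 0 \<le> x \<longrightarrow>
    \<bar>block_coeff a n (nat \<lfloor>real n * x\<rfloor>) / real n powr d\<bar> \<le> (if x < 2 then C else C * x powr (d - 1))"
proof -
  have d: "0 < d" "d < 1" and c: "c > 0" and asy: "a \<sim>[sequentially] (\<lambda>i. c * real i powr (d - 1))"
    using a by (auto simp: long_memory_def)
  have "Bseq (\<lambda>N. coeff_sum a N / real N powr d)"
    using coeff_sum_asymptotics[OF a] by (intro convergent_imp_Bseq convergentI)
  then obtain C1 where C1: "C1 > 0" "\<And>N. \<bar>coeff_sum a N / real N powr d\<bar> \<le> C1"
    by (auto elim!: BseqE)
  have A: "\<bar>coeff_sum a N\<bar> \<le> C1 * real N powr d" for N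
  proof (cases "N = 0")
    case False
    then show ?thesis using C1(2)[of N] by (simp add: field_simps abs_divide)
  qed (simp add: coeff_sum_def)
  have "(\<lambda>i. a i / (c * real i powr (d - 1))) \<longlonglongrightarrow> 1"
  proof (rule asymp_equivD_strong[OF asy])
    show "\<forall>\<^sub>F i in sequentially. a i \<noteq> 0 \<or> c * real i powr (d - 1) \<noteq> 0"
      using eventually_gt_at_top[of 0] by eventually_elim (use c in auto)
  qed
  then have "Bseq (\<lambda>i. a i / (c * real i powr (d - 1)))"
    by (intro convergent_imp_Bseq convergentI)
  then obtain C2 where C2: "C2 > 0" "\<And>i. \<bar>a i / (c * real i powr (d - 1))\<bar> \<le> C2"
    by (auto elim!: BseqE)
  have ai: "\<bar>a i\<bar> \<le> C2 * c * real i powr (d - 1)" if "i > 0" for i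
    using C2(2)[of i] c that by (simp add: field_simps abs_divide abs_mult)
  \<comment> \<open>First bound: two partial sums of length at most \<open>3 n\<close>. Second
    bound: the halved index \<open>n x / 2\<close> in the decreasing function
    \<open>powr (d - 1)\<close>.\<close>
  define C where "C = max (2 * C1 * 3 powr d) (C2 * c * (1 / 2) powr (d - 1))"
  have C_ge: "2 * C1 * 3 powr d \<le> C" "C2 * c * (1 / 2) powr (d - 1) \<le> C"
    by (simp_all add: C_def)
  have C0: "C \<ge> 0" using C1(1) C_ge(1) by (meson mult_nonneg_nonneg order_trans powr_ge_zero less_imp_le zero_le_numeral)
  have "\<bar>block_coeff a n (nat \<lfloor>real n * x\<rfloor>) / real n powr d\<bar> \<le> (if x < 2 then C else C * x powr (d - 1))"
    if n: "0 < n" and x: "0 \<le> x" for n x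
  proof -
    define N where "N = Suc (nat \<lfloor>real n * x\<rfloor>)"
    have N_bounds: "real n * x \<le> real N" "real N \<le> real n * x + 1"
    proof -
      have "real (nat \<lfloor>real n * x\<rfloor>) = of_int \<lfloor>real n * x\<rfloor>" using x by simp
      then show "real n * x \<le> real N" "real N \<le> real n * x + 1"
        unfolding N_def by linarith+
    qed
    have np: "real n powr d > 0" using n by simp
    show ?thesis
    proof (cases "x < 2")
      case True
      have "real n * x \<le> real n * 2" using True by (intro mult_left_mono) auto
      then have N3: "real N \<le> 3 * real n" using N_bounds(2) n by linarith
      have "\<bar>block_coeff a n (nat \<lfloor>real n * x\<rfloor>)\<bar> \<le> \<bar>coeff_sum a N\<bar> + \<bar>coeff_sum a (N - n)\<bar>"
        unfolding block_coeff_def N_def by (rule abs_triangle_ineq4)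
      also have "\<dots> \<le> C1 * real N powr d + C1 * real (N - n) powr d"
        by (intro add_mono A)
      also have "\<dots> \<le> C1 * (3 * real n) powr d + C1 * (3 * real n) powr d"
        using C1(1) d N3 by (intro add_mono mult_left_mono powr_mono2) auto
      also have "\<dots> = 2 * C1 * 3 powr d * real n powr d"
        by (simp add: powr_mult)
      also have "\<dots> \<le> C * real n powr d"
        by (intro mult_right_mono C_ge) simp
      finally show ?thesis using True np by (simp add: abs_divide field_simps)
    next
      case False
      \<comment> \<open>The threshold 2 ensures \<open>x - 1 \<ge> x / 2\<close>.\<close>
      have big: "real n * x / 2 \<le> real (N - n)"
      proof -
        have "real n * 2 \<le> real n * x" using False by (intro mult_left_mono) auto
        then have "real n \<le> real n * x / 2" by simp
        moreover have "real N - real n \<le> real (N - n)" by simp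
        ultimately show ?thesis using N_bounds(1) by linarith
      qed
      have nx: "0 < real n * x / 2" using n False by simp
      have "\<bar>block_coeff a n (nat \<lfloor>real n * x\<rfloor>)\<bar> \<le> (\<Sum>i=N - n..<N. \<bar>a i\<bar>)"
        unfolding block_coeff_eq_sum N_def by (rule sum_abs)
      also have "\<dots> \<le> (\<Sum>i=N - n..<N. C2 * c * (real n * x / 2) powr (d - 1))"
      proof (rule sum_mono)
        fix i assume "i \<in> {N - n..<N}"
        then have i: "real n * x / 2 \<le> real i" using big by simp
        then have "\<bar>a i\<bar> \<le> C2 * c * real i powr (d - 1)" using nx by (intro ai) simp
        also have "\<dots> \<le> C2 * c * (real n * x / 2) powr (d - 1)"
          using nx i d C2(1) c by (intro mult_left_mono powr_mono2') auto
        finally show "\<bar>a i\<bar> \<le> C2 * c * (real n * x / 2) powr (d - 1)" .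
      qed
      also have "\<dots> = real (N - (N - n)) * (C2 * c * (real n * x / 2) powr (d - 1))"
        by simp
      also have "\<dots> \<le> real n * (C2 * c * (real n * x / 2) powr (d - 1))"
        using C2(1) c by (intro mult_right_mono) auto
      also have "(real n * x / 2) powr (d - 1) = real n powr (d - 1) * ((1 / 2) powr (d - 1) * x powr (d - 1))"
        using powr_mult[of "real n" "1 / 2 * x" "d - 1"] powr_mult[of "1/2" x "d - 1"] x by (simp add: mult_ac)
      also have "real n * (C2 * c * (real n powr (d - 1) * ((1 / 2) powr (d - 1) * x powr (d - 1)))) =
          real n powr d * ((C2 * c * (1 / 2) powr (d - 1)) * x powr (d - 1))"
        using n by (simp add: powr_diff)
      also have "\<dots> \<le> real n powr d * (C * x powr (d - 1))"
        by (intro mult_left_mono mult_right_mono C_ge) auto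
      finally show ?thesis using False np by (simp add: abs_divide field_simps)
    qed
  qed
  then show ?thesis using C0 by blast
qed

lemma power_sum_asymptotics_long_memory:
  assumes a: "long_memory a d c" and a2: "summable (\<lambda>i. (a i)\<^sup>2)" and q: "q \<ge> 2"
  shows "(\<lambda>n. (\<Sum>s. block_coeff a n s ^ q) / real n powr (1 + real q * d)) \<longlonglongrightarrow>
    (c / d) ^ q * (1 / (1 + real q * d) + kernel_integral d q)"
proof -
  have d: "0 < d" "d < 1 / 2" using a by (auto simp: long_memory_def)
  obtain C where C: "C \<ge> 0" "\<And>n x. 0 < n \<Longrightarrow> 0 \<le> x \<Longrightarrow>
    \<bar>block_coeff a n (nat \<lfloor>real n * x\<rfloor>) / real n powr d\<bar> \<le> (if x < 2 then C else C * x powr (d - 1))"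
    using block_coeff_dominated[OF a] by blast
  define h where "h x = x powr d - (max 0 (x - 1)) powr d" for x :: real
  have [measurable]: "h \<in> borel_measurable borel" unfolding h_def[abs_def] by measurable
  define f where "f n x = indicator {0..} x * (block_coeff a n (nat \<lfloor>real n * x\<rfloor>) / real n powr d) ^ q" for n and x :: real
  define g where "g x = indicator {0..} x * (c / d * h x) ^ q" for x :: real
  \<comment> \<open>On \<open>x \<ge> 2\<close> the power \<open>x powr (d - 1)\<close> is at most
    1, so exponent \<open>q\<close> may be lowered to 2. Integrability at infinity is
    \<open>2 (d - 1) < -1\<close>, that is, \<open>d < 1/2\<close>.\<close>
  define W where "W x = C ^ q * (indicator {0..2} x + indicator {2..} x * x powr (2 * (d - 1)))" for x :: real
  have [measurable]: "f n \<in> borel_measurable borel" for n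
    unfolding f_def[abs_def] by measurable
  have [measurable]: "g \<in> borel_measurable borel"
    unfolding g_def[abs_def] by measurable
  have int_W: "integrable lborel W"
  proof -
    have "integrable lborel (\<lambda>x::real. indicator {2..} x * x powr (2 * (d - 1)))"
      by (rule integrable_lborel_if_has_integral[OF has_integral_powr_to_inf]) (use d in auto)
    moreover have "integrable lborel (indicator {0..2::real} :: real \<Rightarrow> real)"
      by simp
    ultimately show ?thesis
      unfolding W_def[abs_def] by (intro integrable_mult_right Bochner_Integration.integrable_add)
  qed
  have bound: "norm (f n x) \<le> W x" if n: "n > 0" for n x
  proof (cases "x \<ge> 0")
    case True
    have Cq: "0 \<le> C ^ q" using C(1) by simp
    have le: "\<bar>f n x\<bar> \<le> (if x < 2 then C else C * x powr (d - 1)) ^ q"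
      unfolding f_def using C(2)[OF n True] True by (simp add: abs_mult power_abs power_mono del: abs_divide)
    show ?thesis
    proof (cases "x < 2")
      case True
      then show ?thesis using le \<open>x \<ge> 0\<close> by (simp add: W_def)
    next
      case False
      have "(x powr (d - 1)) ^ q \<le> (x powr (d - 1)) ^ 2"
        using False d q powr_mono[of "d - 1" 0 x] by (intro power_decreasing) auto
      also have "\<dots> = x powr (2 * (d - 1))"
        by (simp add: power2_eq_square flip: powr_add)
      finally have "C ^ q * (x powr (d - 1)) ^ q \<le> C ^ q * x powr (2 * (d - 1))"
        using Cq by (rule mult_left_mono)
      also have "\<dots> \<le> W x"
        using False Cq by (simp add: W_def mult_left_mono)
      finally show ?thesis using le False by (simp add: power_mult_distrib)
    qed
  qed (simp add: f_def W_def)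
  \<comment> \<open>The dominating bound holds for positive \<open>n\<close>, hence the shift to
    \<open>Suc n\<close>.\<close>
  have lim: "AE x in lborel. (\<lambda>n. f (Suc n) x) \<longlonglongrightarrow> g x"
    using AE_lborel_singleton[of 0] AE_lborel_singleton[of 1]
  proof eventually_elim
    case (elim x)
    show ?case
    proof (cases "x > 0")
      case True
      have "(\<lambda>n. f n x) \<longlonglongrightarrow> g x"
        unfolding f_def g_def h_def
        by (intro tendsto_mult tendsto_power tendsto_const block_coeff_scaled_limit[OF a True elim(2)])
      then show ?thesis by (rule LIMSEQ_Suc)
    qed (use elim in \<open>simp add: f_def g_def\<close>)
  qed
  have bd: "AE x in lborel. norm (f (Suc n) x) \<le> W x" for n
    by (intro AE_I2 bound) simp
  have DCT: "(\<lambda>n. LBINT x. f (Suc n) x) \<longlonglongrightarrow> (LBINT x. g x)"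
    by (rule integral_dominated_convergence[OF _ _ int_W lim bd]) auto
  have int_g: "integrable lborel g"
    by (rule integrable_dominated_convergence[OF _ _ int_W lim bd]) auto
  have "(LBINT x. f n x) = (\<Sum>s. block_coeff a n s ^ q) / real n powr (1 + real q * d)" if n: "n > 0" for n
  proof -
    have "(\<lambda>s. \<bar>(block_coeff a n s / real n powr d) ^ q\<bar>) = (\<lambda>s. \<bar>block_coeff a n s\<bar> ^ q / (real n powr d) ^ q)"
      by (simp add: power_abs power_divide abs_divide)
    then have sm: "summable (\<lambda>s. \<bar>(block_coeff a n s / real n powr d) ^ q\<bar>)"
      by (simp only: summable_divide summable_power_ge_2 summable_block_coeff_square a2 q)
    \<comment> \<open>The cell length \<open>1 / n\<close> accounts for the 1 in the exponent
      \<open>1 + q d\<close>.\<close>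
    have "(LBINT x. f n x) = (\<Sum>s. (block_coeff a n s / real n powr d) ^ q) / real n"
      unfolding f_def using n by (intro LBINT_nat_floor[OF sm]) simp
    also have "(\<Sum>s. (block_coeff a n s / real n powr d) ^ q) = (\<Sum>s. block_coeff a n s ^ q) / (real n powr d) ^ q"
      using summable_power_ge_2[OF summable_block_coeff_square[OF a2, of n] q]
      by (simp add: power_divide suminf_divide summable_rabs_cancel power_abs)
    also have "(real n powr d) ^ q = real n powr (real q * d)"
      using n by (simp add: powr_realpow[symmetric] powr_powr mult.commute)
    finally show ?thesis using n by (simp add: powr_add mult.commute)
  qed
  with DCT have "(\<lambda>n. (\<Sum>s. block_coeff a (Suc n) s ^ q) / real (Suc n) powr (1 + real q * d)) \<longlonglongrightarrow> (LBINT x. g x)"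
    by simp
  then have main: "(\<lambda>n. (\<Sum>s. block_coeff a n s ^ q) / real n powr (1 + real q * d)) \<longlonglongrightarrow> (LBINT x. g x)"
    by (rule LIMSEQ_imp_Suc)
  \<comment> \<open>Splitting at 1 separates the innovations dated from 1 to \<open>n\<close>, which
    give \<open>1 / (1 + q d)\<close>, from the earlier ones, which after a shift by 1 give the
    kernel integral.\<close>
  have "(LBINT x. g x) = (LBINT x. indicator {0..1} x * g x + indicator {1<..} x * g x)"
    by (rule Bochner_Integration.integral_cong) (auto simp: g_def indicator_def)
  also have "\<dots> = (LBINT x. indicator {0..1} x * g x) + (LBINT x. indicator {1<..} x * g x)"
    using integrable_mult_indicator[OF _ int_g, of "{0..1}"] integrable_mult_indicator[OF _ int_g, of "{1<..}"]
    by (intro Bochner_Integration.integral_add) auto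
  also have "(LBINT x. indicator {0..1} x * g x) = (c / d) ^ q * (1 / (1 + real q * d))"
  proof -
    have "(LBINT x. indicator {0..1} x * g x) = (LBINT x. (c / d) ^ q * (indicator {0..1} x * x powr (real q * d)))"
    proof (rule Bochner_Integration.integral_cong)
      fix x :: real
      have "(x powr d) ^ q = x powr (real q * d)" if "x \<ge> 0"
        using that q d by (cases "x = 0") (simp_all add: powr_realpow[symmetric] powr_powr mult.commute)
      then show "indicator {0..1} x * g x = (c / d) ^ q * (indicator {0..1} x * x powr (real q * d))"
        using d by (auto simp: g_def h_def indicator_def power_mult_distrib power_divide max_def)
    qed simp
    also have "\<dots> = (c / d) ^ q * (LBINT x. indicator {0..1} x * x powr (real q * d))"
      by simp
    also have "(LBINT x. indicator {0..1} x * x powr (real q * d)) = 1 powr (real q * d + 1) / (real q * d + 1)"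
    proof (rule integrable_lborel_if_has_integral(2)[OF has_integral_powr_from_0])
      have "0 \<le> real q * d" using d by simp
      then show "-1 < real q * d" by linarith
    qed auto
    finally show ?thesis by (simp add: add.commute)
  qed
  also have "(LBINT x. indicator {1<..} x * g x) = (c / d) ^ q * kernel_integral d q"
  proof -
    have "(LBINT x. indicator {1<..} x * g x) = \<bar>1\<bar> *\<^sub>R (LBINT x. indicator {1<..} (1 + 1 * x) * g (1 + 1 * x))"
      by (rule lborel_integral_real_affine) simp
    also have "\<dots> = (LBINT x. (c / d) ^ q * (indicator {0<..} x *\<^sub>R ((1 + x) powr d - x powr d) ^ q))"
      unfolding abs_one scaleR_one
      by (rule Bochner_Integration.integral_cong)
         (auto simp: g_def h_def indicator_def power_mult_distrib power_divide max_def)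
    finally show ?thesis
      by (simp add: kernel_integral_def set_lebesgue_integral_def)
  qed
  finally show ?thesis
    using main by (simp only: distrib_left)
qed

section \<open>Limits of the moments\<close>

text \<open>The coefficients of \<open>exp (w t^2) (1 + \<kappa> t^3)\<close>: a centred Gaussian of
  variance \<open>2 w\<close> with a first-order skewness correction. Order 1 is separate because
  the truncated \<open>1 - 3\<close> would give \<open>\<kappa>\<close> instead of 0.\<close>

definition limit_moment :: "real \<Rightarrow> real \<Rightarrow> nat \<Rightarrow> real" where
  "limit_moment w \<kappa> q =
    (if even q then w ^ (q div 2) / fact (q div 2)
     else if q = 1 then 0 else \<kappa> * w ^ ((q - 3) div 2) / fact ((q - 3) div 2))"

text \<open>Differentiating \<open>exp (w t^2) (1 + \<kappa> t^3)\<close> gives \<open>2 w t\<close>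
  times the series plus \<open>3 \<kappa> t^2 exp (w t^2)\<close>. The last factor is even, so its
  contribution needs \<open>p\<close> even.\<close>

lemma limit_moment_recurrence:
  assumes p: "p \<ge> 1"
  shows "real (Suc p) * limit_moment w \<kappa> (Suc p) =
    2 * w * limit_moment w \<kappa> (p - 1) + (if even p then 3 * \<kappa> * limit_moment w \<kappa> (p - 2) else 0)"
proof (cases "even p")
  case False
  then obtain j where j: "p = 2 * j + 1" by (auto elim: oddE)
  have "limit_moment w \<kappa> (Suc p) = w * w ^ j / (real (Suc j) * fact j)"
    and "limit_moment w \<kappa> (p - 1) = w ^ j / fact j"
    by (simp_all add: limit_moment_def j)
  moreover have "real (Suc p) = 2 * real (Suc j)" by (simp add: j)
  ultimately show ?thesis
    using False by (simp del: of_nat_Suc)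
next
  case True
  then obtain j' where "p = 2 * j'" by (auto elim: evenE)
  with p obtain j where j: "p = 2 * Suc j" by (cases j') auto
  show ?thesis
  proof (cases j)
    case 0
    then show ?thesis using j by (simp add: limit_moment_def)
  next
    case (Suc i)
    define r where "r = real (Suc i)"
    have r: "r > 0" by (simp add: r_def)
    have eqs: "limit_moment w \<kappa> (Suc p) = \<kappa> * w * w ^ i / (r * fact i)"
      "limit_moment w \<kappa> (p - 1) = \<kappa> * w ^ i / fact i"
      "limit_moment w \<kappa> (p - 2) = w * w ^ i / (r * fact i)"
      "real (Suc p) = 2 * r + 3"
      by (simp_all add: limit_moment_def j Suc r_def)
    show ?thesis
      unfolding eqs using True r by (simp add: field_simps)
  qed
qed

lemma scaled_moment_limit:
  fixes g t :: "nat \<Rightarrow> nat \<Rightarrow> real" and L v :: "nat \<Rightarrow> real"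
  assumes g0: "\<And>n. g 0 n = 1"
    and rec: "\<And>p n. Suc p \<le> k \<Longrightarrow>
      real (Suc p) * g (Suc p) n = (\<Sum>i=1..p. L i * t (Suc i) n * g (p - i) n)"
    and t: "\<And>q. q \<ge> 2 \<Longrightarrow> (\<lambda>n. t q n / real n powr (1 + real q * d)) \<longlonglongrightarrow> v q"
    and q: "q \<le> k"
  shows "(\<lambda>n. g q n / real n powr (real q * d + real (q div 2))) \<longlonglongrightarrow>
    limit_moment (L 1 * v 2 / 2) (L 2 * v 3 / 3) q"
  using q
proof (induction q rule: less_induct)
  case (less q)
  let ?H = "limit_moment (L 1 * v 2 / 2) (L 2 * v 3 / 3)"
  consider "q = 0" | "q = 1" | p where "q = Suc p" "p \<ge> 1"
    by (metis One_nat_def Suc_leI gr0_conv_Suc not_gr0)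
  then show ?case
  proof cases
    case 1
    have "\<forall>\<^sub>F n in sequentially. 1 = g q n / real n powr (real q * d + real (q div 2))"
      using eventually_gt_at_top[of 0] by eventually_elim (simp add: 1 g0)
    from Lim_transform_eventually[OF tendsto_const this] show ?thesis
      by (simp add: 1 limit_moment_def)
  next
    case 2
    then have "g q n = 0" for n using rec[of 0 n] less.prems by simp
    then show ?thesis by (simp add: 2 limit_moment_def)
  next
    case (3 p)
    \<comment> \<open>The power of \<open>n\<close> by which the term \<open>i\<close> falls short
      of the leading order; \<open>z i\<close> is the limit of the corresponding factor.\<close>
    define \<delta> where "\<delta> i = real (q div 2) - 1 - real ((p - i) div 2)" for i
    define z where "z i = (if i = 1 \<or> (i = 2 \<and> even p) then 1 else 0 :: real)" for i :: nat
    have z: "(\<lambda>n. real n powr (- \<delta> i)) \<longlonglongrightarrow> z i" if i: "i \<in> {1..p}" for i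
    proof (cases "i = 1 \<or> (i = 2 \<and> even p)")
      case True
      have \<delta>: "\<delta> i = 0"
      proof -
        have "q div 2 = Suc ((p - i) div 2)" using True i 3 by presburger
        then show ?thesis by (simp add: \<delta>_def)
      qed
      have "\<forall>\<^sub>F n in sequentially. 1 = real n powr (- \<delta> i)"
        using eventually_gt_at_top[of 0] by eventually_elim (simp add: \<delta>)
      then have "(\<lambda>n. real n powr (- \<delta> i)) \<longlonglongrightarrow> 1"
        by (rule Lim_transform_eventually[OF tendsto_const])
      moreover have "z i = 1" using True by (simp add: z_def)
      ultimately show ?thesis by (simp only:)
    next
      case False
      then have "Suc ((p - i) div 2) < q div 2" using i 3 by presburger
      then have "\<delta> i > 0" by (simp add: \<delta>_def)
      then have "(\<lambda>n. real n powr (- \<delta> i)) \<longlonglongrightarrow> 0"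
        by (intro tendsto_neg_powr filterlim_real_sequentially) simp
      moreover have "z i = 0" using False by (simp add: z_def)
      ultimately show ?thesis by (simp only:)
    qed
    have lim: "(\<lambda>n. (\<Sum>i=1..p. L i * (t (Suc i) n / real n powr (1 + real (Suc i) * d)) *
        (g (p - i) n / real n powr (real (p - i) * d + real ((p - i) div 2))) * real n powr (- \<delta> i)) / real q)
      \<longlonglongrightarrow> (\<Sum>i=1..p. L i * v (Suc i) * ?H (p - i) * z i) / real q"
      using 3 less.prems by (intro tendsto_divide tendsto_sum tendsto_mult tendsto_const t less.IH z) auto
    have "\<forall>\<^sub>F n in sequentially. (\<Sum>i=1..p. L i * (t (Suc i) n / real n powr (1 + real (Suc i) * d)) *
        (g (p - i) n / real n powr (real (p - i) * d + real ((p - i) div 2))) * real n powr (- \<delta> i)) / real q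
      = g q n / real n powr (real q * d + real (q div 2))"
      using eventually_gt_at_top[of 0]
    proof eventually_elim
      case (elim n)
      have "L i * (t (Suc i) n / real n powr (1 + real (Suc i) * d)) *
          (g (p - i) n / real n powr (real (p - i) * d + real ((p - i) div 2))) * real n powr (- \<delta> i) =
        L i * t (Suc i) n * g (p - i) n / real n powr (real q * d + real (q div 2))" if i: "i \<in> {1..p}" for i
      proof -
        have e: "real q * d + real (q div 2) =
            (1 + real (Suc i) * d) + (real (p - i) * d + real ((p - i) div 2)) + \<delta> i"
          using i by (simp add: \<delta>_def 3 of_nat_diff algebra_simps)
        have "real n powr (real q * d + real (q div 2)) = real n powr (1 + real (Suc i) * d) *
            real n powr (real (p - i) * d + real ((p - i) div 2)) * real n powr (\<delta> i)"
          unfolding e by (simp only: powr_add)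
        then show ?thesis
          by (simp only: powr_minus divide_inverse inverse_mult_distrib mult_ac)
      qed
      then have "(\<Sum>i=1..p. L i * (t (Suc i) n / real n powr (1 + real (Suc i) * d)) *
          (g (p - i) n / real n powr (real (p - i) * d + real ((p - i) div 2))) * real n powr (- \<delta> i)) =
        (\<Sum>i=1..p. L i * t (Suc i) n * g (p - i) n) / real n powr (real q * d + real (q div 2))"
        unfolding sum_divide_distrib by (rule sum.cong[OF refl])
      also have "(\<Sum>i=1..p. L i * t (Suc i) n * g (p - i) n) = real q * g q n"
        using rec[of p n] less.prems 3 by simp
      finally show ?case using 3 by simp
    qed
    from Lim_transform_eventually[OF lim this]
    have *: "(\<lambda>n. g q n / real n powr (real q * d + real (q div 2))) \<longlonglongrightarrow>
      (\<Sum>i=1..p. L i * v (Suc i) * ?H (p - i) * z i) / real q" .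
    have "(\<Sum>i=1..p. L i * v (Suc i) * ?H (p - i) * z i) = (\<Sum>i\<in>{1..p} \<inter> {1, 2}. L i * v (Suc i) * ?H (p - i) * z i)"
      by (rule sum.mono_neutral_right) (auto simp: z_def)
    also have "\<dots> = L 1 * v 2 * ?H (p - 1) + (if even p then L 2 * v 3 * ?H (p - 2) else 0)"
    proof (cases "p = 1")
      case True
      then show ?thesis by (simp add: z_def numeral_2_eq_2)
    next
      case False
      then have "{1..p} \<inter> {1, 2} = {1, 2}" using 3 by auto
      then show ?thesis by (simp add: z_def numeral_3_eq_3 numeral_2_eq_2)
    qed
    also have "\<dots> = real q * ?H q"
      using limit_moment_recurrence[OF 3(2), of "L 1 * v 2 / 2" "L 2 * v 3 / 3"] by (simp add: 3)
    finally show ?thesis using * 3 by simp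
  qed
qed

text \<open>For \<open>d = 0\<close> the kernel vanishes on the open half-line, so one formula
  covers both regimes.\<close>

lemma power_sum_asymptotics:
  assumes "memory_parameter a d c" "summable (\<lambda>i. (a i)\<^sup>2)" "q \<ge> 2"
  shows "(\<lambda>n. (\<Sum>s. block_coeff a n s ^ q) / real n powr (1 + real q * d)) \<longlonglongrightarrow>
    memory_const a d c ^ q * (1 / (1 + real q * d) + kernel_integral d q)"
proof (cases "d = 0")
  case True
  have "kernel_integral 0 q = 0"
  proof -
    have eq: "indicator {0<..} x *\<^sub>R ((1 + x) powr 0 - x powr 0) ^ q = (0 :: real)" for x :: real
      using assms(3) by (auto simp: indicator_def)
    show ?thesis
      unfolding kernel_integral_def set_lebesgue_integral_def eq by simp
  qed
  then show ?thesis
    using True power_sum_asymptotics_short_memory[of a q] assms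
    by (simp add: memory_parameter_def short_memory_def memory_const_def)
next
  case False
  then show ?thesis
    using power_sum_asymptotics_long_memory[of a d c q] assms
    by (simp add: memory_parameter_def memory_const_def)
qed

section \<open>Application to the linear process\<close>

context innovations
begin

lemma iid_sequence_innovations:
  assumes "k \<ge> 2" "integrable M (\<lambda>\<omega>. \<epsilon> 1 \<omega> ^ k)"
  shows "iid_sequence M (\<lambda>s. \<epsilon> (t - int s)) k"
proof
  have [measurable]: "\<epsilon> i \<in> borel_measurable M" for i
    using indep by (auto simp: indep_vars_def)
  show "indep_vars (\<lambda>_. borel) (\<lambda>s. \<epsilon> (t - int s)) UNIV"
    by (rule indep_vars_inj_reindex[OF indep]) (auto simp: inj_def)
  show "distr M borel (\<epsilon> (t - int i)) = distr M borel (\<epsilon> (t - int 0))" for i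
    by (simp only: ident[of "t - int i"] ident[of "t - int 0"])
  have "integral\<^sup>L (distr M borel (\<epsilon> t)) (\<lambda>x. x) = integral\<^sup>L (distr M borel (\<epsilon> 1)) (\<lambda>x. x)"
    by (simp only: ident[of t])
  then show "expectation (\<epsilon> (t - int 0)) = 0"
    using mean_zero by (simp add: integral_distr)
  have "integrable (distr M borel (\<epsilon> t)) (\<lambda>x. x ^ k) = integrable (distr M borel (\<epsilon> 1)) (\<lambda>x. x ^ k)"
    by (simp only: ident[of t])
  then show "integrable M (\<lambda>\<omega>. \<epsilon> (t - int 0) \<omega> ^ k)"
    using assms(2) by (simp add: integrable_distr_eq)
qed fact

lemma expectation_innovation_power:
  "expectation (\<lambda>\<omega>. \<epsilon> t \<omega> ^ q) = expectation (\<lambda>\<omega>. \<epsilon> 1 \<omega> ^ q)"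
proof -
  have [measurable]: "\<epsilon> i \<in> borel_measurable M" for i
    using indep by (auto simp: indep_vars_def)
  have "integral\<^sup>L (distr M borel (\<epsilon> t)) (\<lambda>x. x ^ q) = integral\<^sup>L (distr M borel (\<epsilon> 1)) (\<lambda>x. x ^ q)"
    by (simp only: ident[of t])
  then show ?thesis
    by (simp add: integral_distr)
qed

lemma expectation_innovation_square: "expectation (\<lambda>\<omega>. \<epsilon> 1 \<omega> ^ 2) = \<sigma>\<^sup>2"
  using variance mean_zero by simp

lemma AE_summable_linear_process:
  assumes "summable (\<lambda>i. (a i)\<^sup>2)"
  shows "AE \<omega> in M. summable (\<lambda>i. a i * \<epsilon> (t - int i) \<omega>)"
proof (rule AE_summable_indep_vars)
  show "expectation (\<lambda>\<omega>. a i * \<epsilon> (t - int i) \<omega>) = 0" for i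
    using expectation_innovation_power[of "t - int i" 1] mean_zero by simp
  interpret iid_sequence M "\<lambda>s. \<epsilon> (t - int s)" 2
    by (rule iid_sequence_innovations) (auto simp: square_integrable)
  show "indep_vars (\<lambda>_. borel) (\<lambda>i \<omega>. a i * \<epsilon> (t - int i) \<omega>) UNIV"
    by (rule indep_vars_compose2[OF indep, of "\<lambda>i x. a i * x"]) simp
  show "integrable M (\<lambda>\<omega>. (a i * \<epsilon> (t - int i) \<omega>)\<^sup>2)" for i
    using integrable_e_power[of 2 i] by (simp add: power_mult_distrib)
  show "summable (\<lambda>i. expectation (\<lambda>\<omega>. (a i * \<epsilon> (t - int i) \<omega>)\<^sup>2))"
  proof -
    have "expectation (\<lambda>\<omega>. (a i * \<epsilon> (t - int i) \<omega>)\<^sup>2) = (a i)\<^sup>2 * \<sigma>\<^sup>2" for i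
      using expectation_innovation_power[of "t - int i" 2] expectation_innovation_square
      by (simp add: power_mult_distrib)
    then show ?thesis
      using summable_mult2[OF assms] by simp
  qed
qed

text \<open>Outside a null set the series of all \<open>n\<close> variables involved converge
  simultaneously, so there the pointwise \<open>suminf\<close> values are genuine sums.\<close>

lemma partial_sum_sums_block_coeff:
  assumes "summable (\<lambda>i. (a i)\<^sup>2)"
  shows "AE \<omega> in M. (\<lambda>s. block_coeff a n s * \<epsilon> (int n - int s) \<omega>) sums
    partial_sum (linear_process a \<epsilon>) n \<omega>"
proof -
  have "AE \<omega> in M. \<forall>r\<in>{..<n}. summable (\<lambda>i. a i * \<epsilon> (int n - int r - int i) \<omega>)"
    by (intro AE_finite_allI AE_summable_linear_process assms) simp
  then show ?thesis
  proof eventually_elim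
    case (elim \<omega>)
    have eq: "int n - int (i + r) = int n - int r - int i" for i r by simp
    have "(\<lambda>s. block_coeff a n s * \<epsilon> (int n - int s) \<omega>) sums
        (\<Sum>r<n. \<Sum>i. a i * \<epsilon> (int n - int (i + r)) \<omega>)"
      by (rule sums_block_coeff) (use elim in \<open>simp only: eq, blast\<close>)
    also have "(\<Sum>r<n. \<Sum>i. a i * \<epsilon> (int n - int (i + r)) \<omega>) = (\<Sum>r<n. linear_process a \<epsilon> (int n - int r) \<omega>)"
      by (simp only: eq linear_process_def)
    also have "\<dots> = (\<Sum>t=1..n. linear_process a \<epsilon> (int t) \<omega>)"
      by (rule sum.reindex_bij_witness[of _ "\<lambda>t. n - t" "\<lambda>r. n - r"]) (auto simp: of_nat_diff)
    finally show ?case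
      by (simp only: partial_sum_def)
  qed
qed

lemma scaled_moment_partial_sum:
  assumes k: "k \<ge> 2" "integrable M (\<lambda>\<omega>. \<epsilon> 1 \<omega> ^ k)"
    and a: "memory_parameter a d c" "summable (\<lambda>i. (a i)\<^sup>2)"
  defines "S \<equiv> partial_sum (linear_process a \<epsilon>)"
    and "v \<equiv> \<lambda>q. memory_const a d c ^ q * (1 / (1 + real q * d) + kernel_integral d q)"
  shows "(\<lambda>n. expectation (\<lambda>\<omega>. S n \<omega> ^ k) / fact k / real n powr (real k * d + real (k div 2))) \<longlonglongrightarrow>
    limit_moment (\<sigma>\<^sup>2 * v 2 / 2) (expectation (\<lambda>\<omega>. \<epsilon> 1 \<omega> ^ 3) * v 3 / 6) k"
proof -
  define \<nu> where "\<nu> q = expectation (\<lambda>\<omega>. \<epsilon> 1 \<omega> ^ q)" for q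
  have \<nu>01: "\<nu> 0 = 1" "\<nu> 1 = 0" using mean_zero by (simp_all add: \<nu>_def prob_space)
  define L where "L = fps_nth (log_deriv_fps \<nu>)"
  have L: "L 1 = \<sigma>\<^sup>2" "L 2 = expectation (\<lambda>\<omega>. \<epsilon> 1 \<omega> ^ 3) / 2"
  proof -
    have "\<nu> 2 = \<sigma>\<^sup>2" "\<nu> 3 = expectation (\<lambda>\<omega>. \<epsilon> 1 \<omega> ^ 3)"
      unfolding \<nu>_def by (rule expectation_innovation_square refl)+
    with log_deriv_fps_nth[of \<nu>, OF \<nu>01]
    show "L 1 = \<sigma>\<^sup>2" "L 2 = expectation (\<lambda>\<omega>. \<epsilon> 1 \<omega> ^ 3) / 2"
      unfolding L_def by (simp_all only:)
  qed
  have [measurable]: "\<epsilon> i \<in> borel_measurable M" for i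
    using indep by (auto simp: indep_vars_def)
  have [simp]: "S n \<in> borel_measurable M" for n
    unfolding S_def partial_sum_def[abs_def] linear_process_def[abs_def] by measurable
  define g where "g q n = expectation (\<lambda>\<omega>. S n \<omega> ^ q) / fact q" for q n
  have "(\<lambda>n. g k n / real n powr (real k * d + real (k div 2))) \<longlonglongrightarrow> limit_moment (L 1 * v 2 / 2) (L 2 * v 3 / 3) k"
  proof (rule scaled_moment_limit[where t = "\<lambda>q n. \<Sum>s. block_coeff a n s ^ q"])
    show "g 0 n = 1" for n by (simp add: g_def prob_space)
    show "(\<lambda>n. (\<Sum>s. block_coeff a n s ^ q) / real n powr (1 + real q * d)) \<longlonglongrightarrow> v q" if "2 \<le> q" for q
      unfolding v_def by (rule power_sum_asymptotics[OF a that])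
    fix p n assume p: "Suc p \<le> k"
    \<comment> \<open>The reversed sequence changes with \<open>n\<close>, but its moments do not,
      so the same \<open>L\<close> serves for every \<open>n\<close>.\<close>
    interpret E: iid_sequence M "\<lambda>s. \<epsilon> (int n - int s)" k
      by (rule iid_sequence_innovations[OF k])
    have "E.\<mu> = \<nu>"
      by (simp add: fun_eq_iff E.\<mu>_def \<nu>_def expectation_innovation_power[of "int n"])
    moreover have "AE \<omega> in M. (\<lambda>s. block_coeff a n s * \<epsilon> (int n - int s) \<omega>) sums S n \<omega>"
      unfolding S_def by (rule partial_sum_sums_block_coeff[OF a(2)])
    ultimately show "real (Suc p) * g (Suc p) n =
        (\<Sum>i=1..p. L i * (\<Sum>s. block_coeff a n s ^ Suc i) * g (p - i) n)"
      using E.series_moment_recurrence[OF summable_block_coeff_square[OF a(2)] p, of "S n" n]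
      by (simp add: g_def L_def)
  qed simp
  then show ?thesis
    unfolding L g_def by simp
qed

end

theorem theorem1:
  fixes M :: "'w measure" and \<epsilon> :: "int \<Rightarrow> 'w \<Rightarrow> real"
    and a :: "nat \<Rightarrow> real" and d c \<sigma> \<eta> :: real and k :: nat
    and S :: "nat \<Rightarrow> 'w \<Rightarrow> real" and m :: real
  assumes "innovations M \<epsilon> \<sigma>"
    and "\<eta> = prob_space.expectation M (\<lambda>\<omega>. \<epsilon> 1 \<omega> ^ 3)"
    and "0 \<le> d" and "d < 1/2"
    and "summable (\<lambda>i. (a i)\<^sup>2)"
    and "memory_parameter a d c"
    and "k \<ge> 2"
    and "integrable M (\<lambda>\<omega>. \<epsilon> 1 \<omega> ^ k)"
    and "S = partial_sum (linear_process a \<epsilon>)"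
    and "m = memory_const a d c"
  shows "(\<forall>p::nat. p \<ge> 1 \<and> k = 2 * p \<longrightarrow>
      (\<lambda>n. real n powr (- (real p * (1 + 2 * d))) * prob_space.expectation M (\<lambda>\<omega>. S n \<omega> ^ k))
      \<longlonglongrightarrow> m ^ k * \<sigma> ^ k * (fact k / (2 ^ p * fact p))
          * (1 / (1 + 2 * d) + kernel_integral d 2) ^ p)
    \<and> (\<forall>l::nat. k = 3 + 2 * l \<longrightarrow>
      (\<lambda>n. sqrt (real n) * real n powr (- (real k / 2 * (1 + 2 * d)))
          * prob_space.expectation M (\<lambda>\<omega>. S n \<omega> ^ k))
      \<longlonglongrightarrow> m ^ k * \<eta> * \<sigma> ^ (k - 3) * real ((3 + 2 * l) choose 3) * (fact (2 * l) / (2 ^ l * fact l))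
          * (1 / (1 + 3 * d) + kernel_integral d 3)
          * (1 / (1 + 2 * d) + kernel_integral d 2) ^ l)"
proof -
  interpret innovations M \<epsilon> \<sigma> by fact
  define J2 where "J2 = 1 / (1 + 2 * d) + kernel_integral d 2"
  define J3 where "J3 = 1 / (1 + 3 * d) + kernel_integral d 3"
  define H where "H = limit_moment (\<sigma>\<^sup>2 * (m ^ 2 * J2) / 2) (\<eta> * (m ^ 3 * J3) / 6) k"
  have "(\<lambda>n. expectation (\<lambda>\<omega>. S n \<omega> ^ k) / fact k / real n powr (real k * d + real (k div 2))) \<longlonglongrightarrow> H"
    using scaled_moment_partial_sum[OF assms(7,8,6,5)] by (simp add: assms H_def J2_def J3_def)
  then have "(\<lambda>n. fact k * (expectation (\<lambda>\<omega>. S n \<omega> ^ k) / fact k / real n powr (real k * d + real (k div 2)))) \<longlonglongrightarrow> fact k * H"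
    by (rule tendsto_mult_left)
  moreover have "fact k * (expectation (\<lambda>\<omega>. S n \<omega> ^ k) / fact k / real n powr (real k * d + real (k div 2))) =
      real n powr (- (real k * d + real (k div 2))) * expectation (\<lambda>\<omega>. S n \<omega> ^ k)" for n
    unfolding powr_minus by (simp add: divide_inverse)
  ultimately have lim: "(\<lambda>n. real n powr (- (real k * d + real (k div 2))) * expectation (\<lambda>\<omega>. S n \<omega> ^ k)) \<longlonglongrightarrow> fact k * H"
    by (simp only:)
  have "(\<lambda>n. real n powr (- (real p * (1 + 2 * d))) * expectation (\<lambda>\<omega>. S n \<omega> ^ k))
      \<longlonglongrightarrow> m ^ k * \<sigma> ^ k * (fact k / (2 ^ p * fact p)) * J2 ^ p" if kp: "k = 2 * p" for p
  proof -
    have "real k * d + real (k div 2) = real p * (1 + 2 * d)"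
      by (simp add: kp algebra_simps)
    moreover have "fact k * H = m ^ k * \<sigma> ^ k * (fact k / (2 ^ p * fact p)) * J2 ^ p"
      by (simp add: H_def limit_moment_def kp power_mult power_mult_distrib power_divide)
    ultimately show ?thesis using lim by simp
  qed
  moreover have "(\<lambda>n. sqrt (real n) * real n powr (- (real k / 2 * (1 + 2 * d))) * expectation (\<lambda>\<omega>. S n \<omega> ^ k))
      \<longlonglongrightarrow> m ^ k * \<eta> * \<sigma> ^ (k - 3) * real ((3 + 2 * l) choose 3) * (fact (2 * l) / (2 ^ l * fact l)) * J3 * J2 ^ l"
    if kl: "k = 3 + 2 * l" for l
  proof -
    have "k div 2 = Suc l" using kl by simp
    \<comment> \<open>Here \<open>k\<close> is odd, so \<open>k / 2\<close> exceeds
      \<open>k div 2\<close> by the half that \<open>sqrt n\<close> makes up.\<close>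
    then have "1 / 2 + - (real k / 2 * (1 + 2 * d)) = - (real k * d + real (k div 2))"
      by (simp add: kl field_simps)
    then have "sqrt (real n) * real n powr (- (real k / 2 * (1 + 2 * d))) = real n powr (- (real k * d + real (k div 2)))" for n
      by (simp only: powr_half_sqrt[symmetric] of_nat_0_le_iff flip: powr_add)
    moreover have "fact k * H =
      m ^ k * \<eta> * \<sigma> ^ (k - 3) * real ((3 + 2 * l) choose 3) * (fact (2 * l) / (2 ^ l * fact l)) * J3 * J2 ^ l"
    proof -
      have "real ((3 + 2 * l) choose 3) = fact k / (6 * fact (2 * l))"
        by (subst binomial_fact) (simp_all add: kl fact_numeral)
      moreover have "H = \<eta> * (m ^ 3 * J3) / 6 * (\<sigma>\<^sup>2 * (m ^ 2 * J2) / 2) ^ l / fact l"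
        by (simp add: H_def limit_moment_def kl)
      moreover have "m ^ k = m ^ 3 * (m ^ 2) ^ l" "\<sigma> ^ (k - 3) = (\<sigma>\<^sup>2) ^ l"
        by (simp_all add: kl power_add power_mult)
      ultimately show ?thesis
        by (simp add: power_mult_distrib power_divide mult_ac)
    qed
    ultimately show ?thesis using lim by simp
  qed
  ultimately show ?thesis
    unfolding J2_def J3_def by blast
qed

end
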